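(* Let $g:\mathbb{R}^d\to\mathbb{R}$ be continuously differentiable and non-negative with $\|\nabla g(\theta)-\nabla g(\theta')\|\le L\|\theta-\theta'\|$ for all $\theta,\theta'\in\mathbb{R}^d$. Let $\{\theta_n\}_{n\ge1}$ be generated by AdaGrad-Norm, and suppose that for all $n\ge 1$: (i) $\mathbb{E}[\nabla g(\theta_n,\xi_n)\mid\mathscr{F}_{n-1}]=\nabla g(\theta_n)$; (ii) $\mathbb{E}[\|\nabla g(\theta_n,\xi_n)\|^2\mid\mathscr{F}_{n-1}]\le\sigma_0\|\nabla g(\theta_n)\|^2+\sigma_1$ for some constants $\sigma_0,\sigma_1\ge0$. Then for any $\theta_1\in\mathbb{R}^d$ and any $S_0>0$, $$\frac1T\sum_{n=1}^T\mathbb{E}\|\nabla g(\theta_n)\|^2\le\mathcal{O}\Big(\frac{\ln T}{\sqrt T}\Big)\quad\text{and}\quad \min_{1\le n\le T}\mathbb{E}\big[\|\nabla g(\theta_n)\|^2\big]\le\mathcal{O}\Big(\frac{\ln T}{\sqrt T}\Big).$$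
   Context: AdaGrad-Norm: given an initial point $\theta_1\in\mathbb{R}^d$ and constants $S_0>0$, $\alpha_0>0$, for $n\ge1$ $$S_n=S_{n-1}+\|\nabla g(\theta_n,\xi_n)\|^2,\qquad \theta_{n+1}=\theta_n-\frac{\alpha_0}{\sqrt{S_n}}\nabla g(\theta_n,\xi_n).$$ Here $\{\xi_n\}_{n\ge1}$ is a sequence of independent random variables and $\nabla g(\theta_n,\xi_n)\in\mathbb{R}^d$ is the random vector (stochastic gradient) returned by a stochastic first-order oracle at $\theta_n$ with noise $\xi_n$. The filtration is $\mathscr{F}_n=\sigma\{\theta_1,\xi_1,\dots,\xi_n\}$ for $n\ge1$ and $\mathscr{F}_0=\{\emptyset,\Omega\}$. The $\mathcal{O}(\cdot)$ is as $T\to\infty$, with a hidden constant independent of $T$. *)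

theory Defs
  imports "HOL-Probability.Probability" "HOL-Library.Landau_Symbols"
begin

text \<open>
  The library's conditional expectation \<^const>\<open>real_cond_exp\<close> is real-valued; for random
  vectors we take it componentwise.
\<close>

definition vec_cond_exp ::
    "'w measure \<Rightarrow> 'w measure \<Rightarrow> ('w \<Rightarrow> real ^ 'd) \<Rightarrow> 'w \<Rightarrow> real ^ 'd"
  where "vec_cond_exp M F X \<omega> = (\<chi> i. real_cond_exp M F (\<lambda>\<omega>'. X \<omega>' $ i) \<omega>)"

definition noise_filtration ::
    "'w measure \<Rightarrow> 'x measure \<Rightarrow> ('w \<Rightarrow> real ^ 'd) \<Rightarrow> (nat \<Rightarrow> 'w \<Rightarrow> 'x) \<Rightarrow> nat \<Rightarrow> 'w measure"
  where "noise_filtration M N X \<xi> n =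
    (if n = 0 then sigma (space M) {{}, space M}
     else sigma (space M)
       ({X -` A \<inter> space M | A. A \<in> sets borel} \<union>
        (\<Union>k\<in>{1..n}. {\<xi> k -` A \<inter> space M | A. A \<in> sets N})))"

text \<open>
  The recursion along one trajectory: \<open>G\<close> is the stochastic gradient oracle, \<open>x\<close>, \<open>s\<close>, \<open>z\<close> are
  the realised iterates, accumulators and noises. Iterates and noises are indexed from 1 and
  accumulators from 0; \<open>x 0\<close> and \<open>z 0\<close> are unused.
\<close>

definition adagrad_norm ::
    "(real ^ 'd \<Rightarrow> 'x \<Rightarrow> real ^ 'd) \<Rightarrow> real ^ 'd \<Rightarrow> real \<Rightarrow> real \<Rightarrow>
     (nat \<Rightarrow> real ^ 'd) \<Rightarrow> (nat \<Rightarrow> real) \<Rightarrow> (nat \<Rightarrow> 'x) \<Rightarrow> bool"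
  where "adagrad_norm G \<theta>\<^sub>1 S\<^sub>0 \<alpha>\<^sub>0 x s z \<longleftrightarrow>
    x 1 = \<theta>\<^sub>1 \<and> s 0 = S\<^sub>0 \<and>
    (\<forall>n\<ge>1. s n = s (n - 1) + (norm (G (x n) (z n)))\<^sup>2 \<and>
            x (n + 1) = x n - (\<alpha>\<^sub>0 / sqrt (s n)) *\<^sub>R G (x n) (z n))"

lemma space_noise_filtration [simp]: "space (noise_filtration M N X \<xi> n) = space M"
  by (auto simp: noise_filtration_def intro!: space_measure_of)

lemma measurable_noise:
  assumes "1 \<le> k" "k \<le> n" "\<xi> k \<in> space M \<rightarrow> space N"
  shows "\<xi> k \<in> measurable (noise_filtration M N X \<xi> n) N"
proof (rule measurableI)
  show "\<xi> k \<omega> \<in> space N" if "\<omega> \<in> space (noise_filtration M N X \<xi> n)" for \<omega>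
    using that assms(3) by auto
next
  fix A assume A: "A \<in> sets N"
  have "\<xi> k -` A \<inter> space M \<in> sets (noise_filtration M N X \<xi> n)"
    using assms(1,2) A unfolding noise_filtration_def
    by (auto intro!: in_measure_of)
  thus "\<xi> k -` A \<inter> space (noise_filtration M N X \<xi> n) \<in> sets (noise_filtration M N X \<xi> n)"
    by simp
qed

text \<open>
  Joint measurability of the oracle implies that the stochastic gradients are adapted to the
  noise filtration.
\<close>

lemma jointly_measurable_adapted:
  fixes \<theta> :: "nat \<Rightarrow> 'w \<Rightarrow> real ^ 'd"
  assumes G: "(\<lambda>(x, z). G x z) \<in> borel_measurable (borel \<Otimes>\<^sub>M N)"
    and xi: "\<And>k. 1 \<le> k \<Longrightarrow> \<xi> k \<in> space M \<rightarrow> space N"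
    and run: "\<And>\<omega>. \<omega> \<in> space M \<Longrightarrow>
      adagrad_norm G \<theta>\<^sub>1 S\<^sub>0 \<alpha>\<^sub>0 (\<lambda>n. \<theta> n \<omega>) (\<lambda>n. S n \<omega>) (\<lambda>n. \<xi> n \<omega>)"
    and n: "1 \<le> n"
  shows "(\<lambda>\<omega>. G (\<theta> n \<omega>) (\<xi> n \<omega>)) \<in> borel_measurable (noise_filtration M N (\<theta> 1) \<xi> n)"
proof -
  let ?F = "noise_filtration M N (\<theta> 1) \<xi>"
  have grad: "(\<lambda>\<omega>. G (\<theta> k \<omega>) (\<xi> k \<omega>)) \<in> borel_measurable (?F m)"
    if "\<theta> k \<in> borel_measurable (?F m)" "1 \<le> k" "k \<le> m" for k m
  proof -
    have "\<xi> k \<in> measurable (?F m) N"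
      by (rule measurable_noise) (use that xi in auto)
    from measurable_compose[OF measurable_Pair[OF that(1) this] G] show ?thesis by simp
  qed
  have "\<theta> k \<in> borel_measurable (?F m) \<and> S (k - 1) \<in> borel_measurable (?F m)"
    if "1 \<le> k" "k \<le> m" for k m
    using that
  proof (induction k rule: dec_induct)
    case base
    have "\<theta> 1 \<in> borel_measurable (?F m) \<longleftrightarrow> (\<lambda>_. \<theta>\<^sub>1) \<in> borel_measurable (?F m)"
      by (rule measurable_cong) (use run in \<open>auto simp: adagrad_norm_def\<close>)
    moreover have "S 0 \<in> borel_measurable (?F m) \<longleftrightarrow> (\<lambda>_. S\<^sub>0) \<in> borel_measurable (?F m)"
      by (rule measurable_cong) (use run in \<open>auto simp: adagrad_norm_def\<close>)
    ultimately show ?case by simp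
  next
    case (step k)
    have IH: "\<theta> k \<in> borel_measurable (?F m)" "S (k - 1) \<in> borel_measurable (?F m)"
      using step by auto
    have Gk: "(\<lambda>\<omega>. G (\<theta> k \<omega>) (\<xi> k \<omega>)) \<in> borel_measurable (?F m)"
      using grad[OF IH(1)] step by simp
    have "S k \<in> borel_measurable (?F m) \<longleftrightarrow>
        (\<lambda>\<omega>. S (k - 1) \<omega> + (norm (G (\<theta> k \<omega>) (\<xi> k \<omega>)))\<^sup>2) \<in> borel_measurable (?F m)"
      by (rule measurable_cong) (use run step in \<open>auto simp: adagrad_norm_def\<close>)
    hence Sk: "S k \<in> borel_measurable (?F m)"
      using IH Gk by simp
    have "\<theta> (Suc k) \<in> borel_measurable (?F m) \<longleftrightarrow>
        (\<lambda>\<omega>. \<theta> k \<omega> - (\<alpha>\<^sub>0 / sqrt (S k \<omega>)) *\<^sub>R G (\<theta> k \<omega>) (\<xi> k \<omega>)) \<in> borel_measurable (?F m)"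
      by (rule measurable_cong) (use run step in \<open>auto simp: adagrad_norm_def\<close>)
    hence "\<theta> (Suc k) \<in> borel_measurable (?F m)"
      using IH Gk Sk by simp
    with Sk show ?case by simp
  qed
  from grad[OF conjunct1[OF this[OF n order_refl]] n order_refl] show ?thesis .
qed

end

theory Submission
  imports Defs
begin

text \<open>
  Write \<open>x n\<close> for the iterate at which the gradient \<open>\<gamma> n\<close> is sampled and \<open>s n\<close> for the accumulator
  before \<open>\<gamma> n\<close> enters it. The descent inequality for smooth functions, multiplied by
  \<open>sqrt (s (n + 1))\<close>, contains the inner product of \<open>dg (x n)\<close> and \<open>\<gamma> n\<close> without any random weight,
  and its expectation is exactly that of the squared gradient norm. What has to be paid are the
  increments of \<open>sqrt s\<close>, weighted by \<open>g (x n)\<close>. Hence, if \<open>R\<close> bounds \<open>g\<close> along the path up to time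
  \<open>T\<close>, the sum of the expected squared gradient norms is, up to constants, at most the expectation of
  \<open>(R + 1) * sqrt (s T)\<close> (\<open>sum_inner_gradient\<close>). The expectation of \<open>s T\<close> is at most a multiple of
  that sum plus a linear function of \<open>T\<close>, so that Young's inequality yields the rate once the
  expectation of \<open>R\<^sup>2\<close> is known to be of order \<open>(ln T)\<^sup>2\<close> (\<open>self_bounding_rate\<close>).

  The bound \<open>R\<close> comes from the descent inequality itself. Its stochastic term is not centred, since
  the step size contains the gradient sample; in conditional mean, the resulting error is at most a
  quarter of the descent plus \<open>v n * \<Delta> n\<close>, where \<open>v n\<close> is the bound of the conditional second moment
  and \<open>\<Delta> n\<close> is the decrease of \<open>1 / sqrt s\<close>. As \<open>v n\<close> grows with \<open>g (x n)\<close>, this is not summable at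
  sight, but the sum of \<open>g (x n) * \<Delta> n\<close> nearly telescopes (\<open>sum_g_\<Delta>\<close>). So \<open>g\<close> along the path is at
  most a martingale plus a multiple of \<open>1 + K\<close>, where \<open>K\<close> is the sum of the normalised squares and at
  most \<open>ln (s T / s 0)\<close> (\<open>drift_bound\<close>). By Doob's inequality the maximum of the martingale is
  controlled by its quadratic variation, and this in turn by a small multiple of \<open>R\<^sup>2\<close> plus a multiple
  of \<open>1 + K\<^sup>2\<close> (\<open>sum_Y_squares\<close>). The loop closes because at each time \<open>R\<close> is essentially bounded:
  the iterates move by at most \<open>\<alpha>\<close> per step. The same fact bounds the expectation of \<open>s T\<close> by a
  polynomial in \<open>T\<close> and thus that of \<open>K\<^sup>2\<close> by a multiple of \<open>(ln T)\<^sup>2\<close>.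
\<close>

section \<open>Smooth non-negative functions\<close>

locale smooth_nonneg =
  fixes g :: "'a :: real_inner \<Rightarrow> real" and dg :: "'a \<Rightarrow> 'a" and L :: real
  assumes gderiv: "\<And>z. GDERIV g z :> dg z"
    and nonneg: "\<And>z. 0 \<le> g z"
    and lipschitz: "\<And>y z. norm (dg y - dg z) \<le> L * norm (y - z)"
    and L_pos: "0 < L"
begin

lemma descent:
  "g (z + d) \<le> g z + inner (dg z) d + L / 2 * (norm d)\<^sup>2"
proof -
  define f where "f = (\<lambda>t. g (z + t *\<^sub>R d) - t * inner (dg z) d - L / 2 * t\<^sup>2 * (norm d)\<^sup>2)"
  have nonpos: "\<exists>y. (f has_real_derivative y) (at t) \<and> y \<le> 0" if "0 \<le> t" for t
  proof (intro exI conjI)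
    let ?y = "inner d (dg (z + t *\<^sub>R d)) - inner (dg z) d - L * t * (norm d)\<^sup>2"
    have "((\<lambda>t. g (z + t *\<^sub>R d)) has_derivative (\<lambda>h. inner (h *\<^sub>R d) (dg (z + t *\<^sub>R d)))) (at t)"
      by (rule has_derivative_compose[where f = "\<lambda>t. z + t *\<^sub>R d" and g = g and f' = "\<lambda>h. h *\<^sub>R d"])
        (use gderiv in \<open>auto simp: gderiv_def intro!: derivative_eq_intros\<close>)
    then have along: "((\<lambda>t. g (z + t *\<^sub>R d)) has_real_derivative inner d (dg (z + t *\<^sub>R d))) (at t)"
      unfolding has_field_derivative_def by (rule has_derivative_eq_rhs) (auto simp: fun_eq_iff)
    have linear: "((\<lambda>t. t * inner (dg z) d) has_real_derivative inner (dg z) d) (at t)"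
      by (auto intro!: derivative_eq_intros)
    have quadratic: "((\<lambda>t. L / 2 * t\<^sup>2 * (norm d)\<^sup>2) has_real_derivative L * t * (norm d)\<^sup>2) (at t)"
      by (auto intro!: derivative_eq_intros)
    show "(f has_real_derivative ?y) (at t)"
      unfolding f_def by (rule DERIV_diff[OF DERIV_diff[OF along linear] quadratic])
    have "inner d (dg (z + t *\<^sub>R d)) - inner (dg z) d = inner d (dg (z + t *\<^sub>R d) - dg z)"
      by (simp add: inner_diff_right inner_commute)
    also have "\<dots> \<le> norm d * norm (dg (z + t *\<^sub>R d) - dg z)"
      by (rule norm_cauchy_schwarz)
    also have "\<dots> \<le> norm d * (L * norm (t *\<^sub>R d))"
      using lipschitz[of "z + t *\<^sub>R d" z] by (intro mult_left_mono) auto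
    also have "\<dots> = L * t * (norm d)\<^sup>2"
      using that by (simp add: power2_eq_square)
    finally show "?y \<le> 0" by simp
  qed
  have "f 1 \<le> f 0"
    by (rule DERIV_nonpos_imp_nonincreasing) (simp, rule nonpos)
  then show ?thesis by (simp add: f_def)
qed

text \<open>
  A gradient step of length \<open>1 / L\<close> lowers \<open>g\<close> by at least \<open>(norm (dg z))\<^sup>2 / (2 * L)\<close>, and there
  is only \<open>g z\<close> to lose.
\<close>

lemma norm_gradient_le: "(norm (dg z))\<^sup>2 \<le> 2 * L * g z"
proof -
  have "0 \<le> g (z + (- (1 / L)) *\<^sub>R dg z)" by (rule nonneg)
  also have "\<dots> \<le> g z + inner (dg z) ((- (1 / L)) *\<^sub>R dg z)
      + L / 2 * (norm ((- (1 / L)) *\<^sub>R dg z))\<^sup>2"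
    by (rule descent)
  also have "\<dots> = g z - (norm (dg z))\<^sup>2 / (2 * L)"
    using L_pos
    by (simp add: dot_square_norm power_mult_distrib power_divide) (simp add: field_simps power2_eq_square)
  finally show ?thesis using L_pos by (simp add: field_simps)
qed

lemma continuous_gradient: "continuous_on UNIV dg"
proof (rule continuous_onI)
  fix x and e :: real assume "0 < e"
  then show "\<exists>d>0. \<forall>x'\<in>UNIV. dist x' x < d \<longrightarrow> dist (dg x') (dg x) \<le> e"
    using lipschitz[of _ x] L_pos
    by (intro exI[of _ "e / L"]) (auto simp: dist_norm field_simps intro: order_trans less_imp_le)
qed

end

section \<open>One trajectory\<close>

text \<open>
  Trajectories are indexed from 0: \<open>x n\<close> is the iterate at which the gradient \<open>\<gamma> n\<close> is sampled, and
  \<open>s n\<close> is the accumulator before \<open>\<gamma> n\<close> enters it.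
\<close>

locale adagrad_quantities =
  fixes dg :: "'a :: real_inner \<Rightarrow> 'a" and x :: "nat \<Rightarrow> 'a" and \<gamma> :: "nat \<Rightarrow> 'a" and s :: "nat \<Rightarrow> real"
    and \<alpha> \<sigma>\<^sub>0 \<sigma>\<^sub>1 :: real
begin

definition u :: "nat \<Rightarrow> real" where "u n = 1 / sqrt (s n)"
definition \<Delta> :: "nat \<Rightarrow> real" where "\<Delta> n = u n - u (Suc n)"
definition \<Gamma> :: "nat \<Rightarrow> real" where "\<Gamma> n = (norm (\<gamma> n))\<^sup>2 / s (Suc n)"
definition \<zeta> :: "nat \<Rightarrow> real" where "\<zeta> n = (norm (dg (x n)))\<^sup>2 * u n"
definition v :: "nat \<Rightarrow> real" where "v n = \<sigma>\<^sub>0 * (norm (dg (x n)))\<^sup>2 + \<sigma>\<^sub>1"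

text \<open>
  The inner product as the step of the algorithm contains it, lowered by an amount that makes up
  for the correlation between the gradient sample and its normalisation.
\<close>

definition Y :: "nat \<Rightarrow> real"
  where "Y n = - \<alpha> * inner (dg (x n)) (\<gamma> n) * u (Suc n) - \<alpha> * v n * \<Delta> n"

end

locale adagrad_path = smooth_nonneg g dg L + adagrad_quantities dg x \<gamma> s \<alpha> \<sigma>\<^sub>0 \<sigma>\<^sub>1
  for g :: "'a :: real_inner \<Rightarrow> real" and dg :: "'a \<Rightarrow> 'a" and L :: real
    and x \<gamma> :: "nat \<Rightarrow> 'a" and s :: "nat \<Rightarrow> real" and \<alpha> \<sigma>\<^sub>0 \<sigma>\<^sub>1 :: real +
  assumes \<alpha>_pos: "0 < \<alpha>"
    and s0_pos: "0 < s 0"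
    and s_Suc: "\<And>n. s (Suc n) = s n + (norm (\<gamma> n))\<^sup>2"
    and x_Suc: "\<And>n. x (Suc n) = x n - (\<alpha> / sqrt (s (Suc n))) *\<^sub>R \<gamma> n"
    and \<sigma>0_nonneg: "0 \<le> \<sigma>\<^sub>0" and \<sigma>1_pos: "0 < \<sigma>\<^sub>1"
begin

lemma s_mono: "m \<le> n \<Longrightarrow> s m \<le> s n"
  by (rule lift_Suc_mono_le[of s]) (auto simp: s_Suc)

lemma s_pos: "0 < s n"
  using s_mono[of 0 n] s0_pos by simp

lemma u_pos: "0 < u n"
  by (simp add: u_def s_pos)

lemma u_antimono: "m \<le> n \<Longrightarrow> u n \<le> u m"
  using s_mono[of m n] s_pos[of m] s_pos[of n] by (simp add: u_def frac_le)

lemma \<Delta>_nonneg: "0 \<le> \<Delta> n"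
  using u_antimono[of n "Suc n"] by (simp add: \<Delta>_def)

lemma \<Delta>_le: "\<Delta> n \<le> u n"
  using u_pos[of "Suc n"] by (simp add: \<Delta>_def)

lemma \<Delta>_le0: "\<Delta> n \<le> u 0"
  using \<Delta>_le[of n] u_antimono[of 0 n] by simp

lemma sum_\<Delta>: "(\<Sum>k<n. \<Delta> k) \<le> u 0"
proof -
  have "(\<Sum>k<n. \<Delta> k) = u 0 - u n"
    unfolding \<Delta>_def by (rule sum_lessThan_telescope')
  then show ?thesis using u_pos[of n] by simp
qed

lemma \<Gamma>_nonneg: "0 \<le> \<Gamma> n"
  by (simp add: \<Gamma>_def s_pos less_imp_le)

lemma \<Gamma>_le1: "\<Gamma> n \<le> 1"
  using s_pos[of n] s_pos[of "Suc n"] by (simp add: \<Gamma>_def s_Suc)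

lemma \<zeta>_nonneg: "0 \<le> \<zeta> n"
  using u_pos[of n] by (simp add: \<zeta>_def)

lemma \<Gamma>_eq: "\<Gamma> n = (norm (\<gamma> n) * u (Suc n))\<^sup>2"
  using s_pos[of "Suc n"] by (simp add: \<Gamma>_def u_def power_divide)

lemma sqrt_\<Gamma>: "sqrt (\<Gamma> n) = norm (\<gamma> n) * u (Suc n)"
  using u_pos[of "Suc n"] by (simp add: \<Gamma>_eq)

text \<open>
  The normalised squares are relative increments of \<open>s\<close>, so that their sum is a lower Riemann sum
  of \<open>1 / s\<close>.
\<close>

lemma sum_\<Gamma>: "(\<Sum>k<n. \<Gamma> k) \<le> ln (s n / s 0)"
proof -
  have "\<Gamma> k \<le> ln (s (Suc k)) - ln (s k)" for k
  proof -
    have "\<Gamma> k = 1 - s k / s (Suc k)"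
      using s_pos[of "Suc k"] by (simp add: \<Gamma>_def s_Suc field_simps)
    also have "\<dots> \<le> - ln (s k / s (Suc k))"
      using ln_le_minus_one[of "s k / s (Suc k)"] s_pos by simp
    also have "\<dots> = ln (s (Suc k)) - ln (s k)"
      using s_pos[of k] s_pos[of "Suc k"] by (subst ln_div) auto
    finally show ?thesis .
  qed
  then have "(\<Sum>k<n. \<Gamma> k) \<le> (\<Sum>k<n. ln (s (Suc k)) - ln (s k))"
    by (rule sum_mono)
  also have "\<dots> = ln (s n / s 0)"
    using sum_lessThan_telescope[of "\<lambda>k. ln (s k)" n] s_pos[of 0] s_pos[of n]
    by (subst ln_div) auto
  finally show ?thesis .
qed

lemma step_length: "norm (x (Suc n) - x n) \<le> \<alpha>"
proof -
  have "norm (x (Suc n) - x n) = \<alpha> * sqrt (\<Gamma> n)"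
    using \<alpha>_pos s_pos[of "Suc n"] by (simp add: x_Suc sqrt_\<Gamma> u_def)
  also have "\<dots> \<le> \<alpha> * 1"
    using \<alpha>_pos \<Gamma>_le1 by (intro mult_left_mono) (auto simp: real_sqrt_le_1_iff)
  finally show ?thesis by simp
qed

lemma dist_start: "norm (x n - x 0) \<le> \<alpha> * real n"
proof (induction n)
  case (Suc n)
  have "norm (x (Suc n) - x 0) \<le> norm (x (Suc n) - x n) + norm (x n - x 0)"
    by (metis diff_add_cancel add_diff_eq norm_triangle_ineq)
  then show ?case using Suc step_length[of n] by (simp add: algebra_simps)
qed simp

lemma step:
  "g (x (Suc n)) \<le> g (x n) - \<alpha> * inner (dg (x n)) (\<gamma> n) * u (Suc n) + L * \<alpha>\<^sup>2 / 2 * \<Gamma> n"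
proof -
  let ?d = "- (\<alpha> * u (Suc n)) *\<^sub>R \<gamma> n"
  have "x (Suc n) = x n + ?d" by (simp add: x_Suc u_def)
  then have "g (x (Suc n)) \<le> g (x n) + inner (dg (x n)) ?d + L / 2 * (norm ?d)\<^sup>2"
    using descent[of "x n" ?d] by simp
  also have "(norm ?d)\<^sup>2 = \<alpha>\<^sup>2 * \<Gamma> n"
    by (simp add: \<Gamma>_eq power_mult_distrib)
  finally show ?thesis by (simp add: algebra_simps)
qed

text \<open>
  The weight \<open>u\<close> turns the sum of \<open>g (x k) * \<Delta> k\<close> into a telescoping sum plus the increments of
  \<open>g\<close> weighted by \<open>u\<close>, and Young's inequality makes the latter cost as little of \<open>\<zeta>\<close> as desired.
\<close>

lemma sum_g_\<Delta>:
  assumes "0 < \<epsilon>"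
  shows "(\<Sum>k<n. g (x k) * \<Delta> k)
    \<le> g (x 0) * u 0 + \<epsilon> * (\<Sum>k<n. \<zeta> k) + u 0 * \<alpha>\<^sup>2 * (1 / (4 * \<epsilon>) + L / 2) * (\<Sum>k<n. \<Gamma> k)"
proof -
  let ?c = "u 0 * \<alpha>\<^sup>2 * (1 / (4 * \<epsilon>) + L / 2)"
  have one: "g (x k) * \<Delta> k \<le> (g (x k) * u k - g (x (Suc k)) * u (Suc k)) + (\<epsilon> * \<zeta> k + ?c * \<Gamma> k)" for k
  proof -
    let ?b = "norm (dg (x k))" and ?q = "norm (\<gamma> k) * u (Suc k)"
    have q: "0 \<le> ?q" using u_pos[of "Suc k"] by simp
    have "g (x (Suc k)) - g (x k)
        \<le> - \<alpha> * inner (dg (x k)) (\<gamma> k) * u (Suc k) + L * \<alpha>\<^sup>2 / 2 * \<Gamma> k"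
      using step[of k] by simp
    also have "- \<alpha> * inner (dg (x k)) (\<gamma> k) * u (Suc k) \<le> \<alpha> * (?b * norm (\<gamma> k)) * u (Suc k)"
    proof -
      have "- inner (dg (x k)) (\<gamma> k) \<le> ?b * norm (\<gamma> k)"
        using Cauchy_Schwarz_ineq2[of "dg (x k)" "\<gamma> k"] by simp
      then have "\<alpha> * u (Suc k) * (- inner (dg (x k)) (\<gamma> k)) \<le> \<alpha> * u (Suc k) * (?b * norm (\<gamma> k))"
        using \<alpha>_pos u_pos[of "Suc k"] by (intro mult_left_mono) auto
      then show ?thesis by (simp add: algebra_simps)
    qed
    also have "\<alpha> * (?b * norm (\<gamma> k)) * u (Suc k) \<le> \<epsilon> * ?b\<^sup>2 + \<alpha>\<^sup>2 / (4 * \<epsilon>) * \<Gamma> k"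
    proof -
      have "0 \<le> (2 * \<epsilon> * ?b - \<alpha> * ?q)\<^sup>2 / (4 * \<epsilon>)" using assms by simp
      also have "\<dots> = \<epsilon> * ?b\<^sup>2 + \<alpha>\<^sup>2 / (4 * \<epsilon>) * \<Gamma> k - \<alpha> * ?b * ?q"
        using assms by (simp add: \<Gamma>_eq power2_eq_square field_simps)
      finally show ?thesis by (simp add: algebra_simps)
    qed
    finally have inc: "g (x (Suc k)) - g (x k) \<le> \<epsilon> * ?b\<^sup>2 + \<alpha>\<^sup>2 * (1 / (4 * \<epsilon>) + L / 2) * \<Gamma> k"
      by (simp add: algebra_simps)
    have "u (Suc k) * (g (x (Suc k)) - g (x k)) \<le> u (Suc k) * (\<epsilon> * ?b\<^sup>2 + \<alpha>\<^sup>2 * (1 / (4 * \<epsilon>) + L / 2) * \<Gamma> k)"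
      using u_pos[of "Suc k"] inc by (intro mult_left_mono) auto
    also have "\<dots> = u (Suc k) * (\<epsilon> * ?b\<^sup>2) + u (Suc k) * (\<alpha>\<^sup>2 * (1 / (4 * \<epsilon>) + L / 2) * \<Gamma> k)"
      by (simp add: algebra_simps)
    also have "\<dots> \<le> u k * (\<epsilon> * ?b\<^sup>2) + u 0 * (\<alpha>\<^sup>2 * (1 / (4 * \<epsilon>) + L / 2) * \<Gamma> k)"
      using u_antimono[of k "Suc k"] u_antimono[of 0 "Suc k"] assms \<Gamma>_nonneg[of k] L_pos
      by (intro add_mono mult_right_mono) auto
    finally have "u (Suc k) * (g (x (Suc k)) - g (x k)) \<le> \<epsilon> * \<zeta> k + ?c * \<Gamma> k"
      by (simp add: \<zeta>_def algebra_simps)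
    then show ?thesis by (simp add: \<Delta>_def algebra_simps)
  qed
  have "(\<Sum>k<n. g (x k) * \<Delta> k) \<le>
      (\<Sum>k<n. (g (x k) * u k - g (x (Suc k)) * u (Suc k)) + (\<epsilon> * \<zeta> k + ?c * \<Gamma> k))"
    by (rule sum_mono) (rule one)
  also have "\<dots> = (g (x 0) * u 0 - g (x n) * u n) + (\<epsilon> * (\<Sum>k<n. \<zeta> k) + ?c * (\<Sum>k<n. \<Gamma> k))"
    using sum_lessThan_telescope'[of "\<lambda>k. g (x k) * u k" n]
    by (simp only: sum.distrib sum_distrib_left)
  also have "\<dots> \<le> g (x 0) * u 0 + (\<epsilon> * (\<Sum>k<n. \<zeta> k) + ?c * (\<Sum>k<n. \<Gamma> k))"
    using mult_nonneg_nonneg[OF nonneg[of "x n"] less_imp_le[OF u_pos[of n]]] by linarith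
  finally show ?thesis by simp
qed

text \<open>
  Multiplying \<open>step\<close> by \<open>sqrt (s (Suc k))\<close> removes the random normalisation from the inner
  product; the price is paid in increments of \<open>sqrt s\<close>, which telescope once \<open>g\<close> is bounded by \<open>R\<close>.
\<close>

lemma sum_inner_gradient:
  assumes R: "\<And>k. k < n \<Longrightarrow> g (x k) \<le> R"
    and "0 \<le> R"
  shows "\<alpha> * (\<Sum>k<n. inner (dg (x k)) (\<gamma> k)) \<le> sqrt (s 0) * g (x 0) + (R + L * \<alpha>\<^sup>2) * sqrt (s n)"
proof -
  have one: "\<alpha> * inner (dg (x k)) (\<gamma> k) \<le> (sqrt (s k) * g (x k) - sqrt (s (Suc k)) * g (x (Suc k)))
      + (R + L * \<alpha>\<^sup>2) * (sqrt (s (Suc k)) - sqrt (s k))" if "k < n" for k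
  proof -
    let ?r = "sqrt (s (Suc k))" and ?t = "sqrt (s k)" and ?i = "inner (dg (x k)) (\<gamma> k)"
    have r: "0 < ?r" "0 < ?t" "?t \<le> ?r" using s_pos s_mono[of k "Suc k"] by auto
    have r\<Gamma>: "?r * \<Gamma> k \<le> 2 * (?r - ?t)"
    proof -
      have rr: "?r * ?r = s (Suc k)" and tt: "?t * ?t = s k" using s_pos by (auto simp: less_imp_le)
      have "(?r * \<Gamma> k) * ?r = (?r * ?r) * \<Gamma> k" by simp
      also have "\<dots> = (norm (\<gamma> k))\<^sup>2"
        unfolding rr using s_pos[of "Suc k"] by (simp add: \<Gamma>_def)
      also have "\<dots> = ?r * ?r - ?t * ?t" unfolding rr tt by (simp add: s_Suc)
      also have "\<dots> = (?r - ?t) * (?r + ?t)" by (simp add: algebra_simps)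
      also have "\<dots> \<le> (?r - ?t) * (2 * ?r)" using r by (intro mult_left_mono) auto
      finally have "(?r * \<Gamma> k) * ?r \<le> (2 * (?r - ?t)) * ?r" by (simp only: mult_ac)
      then show ?thesis using r(1) by (rule mult_right_le_imp_le)
    qed
    have "?r * g (x (Suc k)) \<le> ?r * (g (x k) - \<alpha> * ?i * u (Suc k) + L * \<alpha>\<^sup>2 / 2 * \<Gamma> k)"
      using r by (intro mult_left_mono step) auto
    also have "\<dots> = ?r * g (x k) - \<alpha> * ?i + L * \<alpha>\<^sup>2 / 2 * (?r * \<Gamma> k)"
      using r by (simp add: u_def algebra_simps)
    also have "\<dots> \<le> ?r * g (x k) - \<alpha> * ?i + L * \<alpha>\<^sup>2 / 2 * (2 * (?r - ?t))"
      using L_pos by (intro add_left_mono mult_left_mono[OF r\<Gamma>]) simp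
    finally have "?r * g (x (Suc k)) \<le> ?r * g (x k) - \<alpha> * ?i + L * \<alpha>\<^sup>2 * (?r - ?t)"
      by (simp add: field_simps)
    moreover have "(?r - ?t) * g (x k) \<le> (?r - ?t) * R"
      using r R[OF that] by (intro mult_left_mono) auto
    ultimately show ?thesis by (simp add: algebra_simps)
  qed
  have "\<alpha> * (\<Sum>k<n. inner (dg (x k)) (\<gamma> k)) \<le> (\<Sum>k<n. (sqrt (s k) * g (x k) - sqrt (s (Suc k)) * g (x (Suc k)))
      + (R + L * \<alpha>\<^sup>2) * (sqrt (s (Suc k)) - sqrt (s k)))"
    unfolding sum_distrib_left by (rule sum_mono) (use one in auto)
  also have "\<dots> = (sqrt (s 0) * g (x 0) - sqrt (s n) * g (x n)) + (R + L * \<alpha>\<^sup>2) * (sqrt (s n) - sqrt (s 0))"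
    using sum_lessThan_telescope'[of "\<lambda>k. sqrt (s k) * g (x k)" n] sum_lessThan_telescope[of "\<lambda>k. sqrt (s k)" n]
    by (simp only: sum.distrib sum_distrib_left[symmetric])
  also have "\<dots> \<le> sqrt (s 0) * g (x 0) + (R + L * \<alpha>\<^sup>2) * sqrt (s n)"
  proof -
    have "0 \<le> sqrt (s n) * g (x n)" "0 \<le> (R + L * \<alpha>\<^sup>2) * sqrt (s 0)"
      using nonneg[of "x n"] s_pos[of n] s_pos[of 0] assms(2) L_pos by auto
    then show ?thesis by (simp add: algebra_simps)
  qed
  finally show ?thesis .
qed

lemma v_pos: "0 < v n"
  using \<sigma>0_nonneg \<sigma>1_pos by (simp add: v_def add_nonneg_pos)

lemma v_le: "v n \<le> 2 * L * \<sigma>\<^sub>0 * g (x n) + \<sigma>\<^sub>1"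
proof -
  have "\<sigma>\<^sub>0 * (norm (dg (x n)))\<^sup>2 \<le> \<sigma>\<^sub>0 * (2 * L * g (x n))"
    using \<sigma>0_nonneg norm_gradient_le by (intro mult_left_mono)
  then show ?thesis by (simp add: v_def mult_ac)
qed

text \<open>
  Young's inequality splits \<open>norm (dg (x n)) * norm (\<gamma> n) * \<Delta> n\<close> with a weight chosen so that the
  first part has conditional expectation at most \<open>\<zeta> n / 4\<close> and the second one is at most
  \<open>v n * \<Delta> n\<close>, by \<open>\<Delta> n \<le> u n\<close>.
\<close>

lemma Y_le: "Y n \<le> - \<alpha> * u n * inner (dg (x n)) (\<gamma> n) + \<alpha> / 4 * (\<zeta> n / v n) * (norm (\<gamma> n))\<^sup>2"
proof -
  let ?b = "norm (dg (x n))" and ?c = "norm (\<gamma> n)" and ?i = "inner (dg (x n)) (\<gamma> n)"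
  have "?i * \<Delta> n \<le> (?b * ?c) * \<Delta> n"
    using \<Delta>_nonneg by (intro mult_right_mono norm_cauchy_schwarz)
  also have "\<dots> \<le> \<zeta> n / (4 * v n) * ?c\<^sup>2 + v n * \<Delta> n"
  proof -
    have "0 \<le> (u n * ?b * ?c - 2 * v n * \<Delta> n)\<^sup>2 / (4 * v n * u n)"
      using v_pos[of n] u_pos[of n] by simp
    also have "\<dots> = \<zeta> n / (4 * v n) * ?c\<^sup>2 + v n * (\<Delta> n * (\<Delta> n / u n)) - ?b * ?c * \<Delta> n"
      using v_pos[of n] u_pos[of n] by (simp add: \<zeta>_def power2_eq_square field_simps)
    finally have "?b * ?c * \<Delta> n \<le> \<zeta> n / (4 * v n) * ?c\<^sup>2 + v n * (\<Delta> n * (\<Delta> n / u n))"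
      by simp
    moreover have "\<Delta> n * (\<Delta> n / u n) \<le> \<Delta> n * 1"
      using \<Delta>_nonneg[of n] \<Delta>_le[of n] u_pos[of n] by (intro mult_left_mono) auto
    ultimately show ?thesis
      using v_pos[of n] mult_left_mono[of "\<Delta> n * (\<Delta> n / u n)" "\<Delta> n" "v n"] by simp
  qed
  finally have "\<alpha> * (?i * \<Delta> n) \<le> \<alpha> * (\<zeta> n / (4 * v n) * ?c\<^sup>2 + v n * \<Delta> n)"
    using \<alpha>_pos by (intro mult_left_mono) auto
  then show ?thesis by (simp add: Y_def \<Delta>_def algebra_simps)
qed

definition drift_const :: real
  where "drift_const = g (x 0) * (1 + 2 * \<alpha> * L * \<sigma>\<^sub>0 * u 0) + \<alpha> * \<sigma>\<^sub>1 * u 0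
    + (2 * \<alpha> * L * \<sigma>\<^sub>0 * (u 0 * \<alpha>\<^sup>2 * (2 * L * \<sigma>\<^sub>0 + 2 + L / 2)) + L * \<alpha>\<^sup>2 / 2)"

text \<open>
  The amounts \<open>\<alpha> * v k * \<Delta> k\<close> that were subtracted in \<open>Y\<close> have to be paid back. By \<open>v_le\<close> and
  \<open>sum_g_\<Delta>\<close> they cost a part of the descent \<open>\<zeta>\<close> and a multiple of the normalised squares. The
  sequence \<open>d\<close> stands for the martingale part of \<open>Y\<close>.
\<close>

lemma drift_bound:
  assumes Y: "\<And>k. k < n \<Longrightarrow> Y k \<le> d k - 3 / 4 * \<alpha> * \<zeta> k"
  shows "g (x n) + \<alpha> / 2 * (\<Sum>k<n. \<zeta> k) \<le> (\<Sum>k<n. d k) + drift_const * (1 + (\<Sum>k<n. \<Gamma> k))"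
proof -
  let ?Z = "\<Sum>k<n. \<zeta> k" and ?K = "\<Sum>k<n. \<Gamma> k" and ?B = "\<Sum>k<n. g (x k) * \<Delta> k"
  have one: "g (x (Suc k)) - g (x k)
      \<le> d k - 3 / 4 * \<alpha> * \<zeta> k + \<alpha> * (2 * L * \<sigma>\<^sub>0 * (g (x k) * \<Delta> k) + \<sigma>\<^sub>1 * \<Delta> k) + L * \<alpha>\<^sup>2 / 2 * \<Gamma> k"
    if "k < n" for k
  proof -
    have "\<alpha> * (v k * \<Delta> k) \<le> \<alpha> * ((2 * L * \<sigma>\<^sub>0 * g (x k) + \<sigma>\<^sub>1) * \<Delta> k)"
      using \<alpha>_pos v_le[of k] \<Delta>_nonneg[of k] by (intro mult_left_mono mult_right_mono) auto
    then show ?thesis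
      using step[of k] Y[OF that] by (simp add: Y_def algebra_simps)
  qed
  have "g (x n) - g (x 0) = (\<Sum>k<n. g (x (Suc k)) - g (x k))"
    by (rule sum_lessThan_telescope[symmetric])
  also have "\<dots> \<le> (\<Sum>k<n. d k - 3 / 4 * \<alpha> * \<zeta> k
      + \<alpha> * (2 * L * \<sigma>\<^sub>0 * (g (x k) * \<Delta> k) + \<sigma>\<^sub>1 * \<Delta> k) + L * \<alpha>\<^sup>2 / 2 * \<Gamma> k)"
    by (rule sum_mono) (use one in auto)
  also have "\<dots> = (\<Sum>k<n. d k) - 3 / 4 * \<alpha> * ?Z + \<alpha> * (2 * L * \<sigma>\<^sub>0 * ?B + \<sigma>\<^sub>1 * (\<Sum>k<n. \<Delta> k)) + L * \<alpha>\<^sup>2 / 2 * ?K"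
    by (simp only: sum.distrib sum_subtractf sum_distrib_left[symmetric])
  also have "\<alpha> * (2 * L * \<sigma>\<^sub>0 * ?B + \<sigma>\<^sub>1 * (\<Sum>k<n. \<Delta> k))
      \<le> \<alpha> / 4 * ?Z + 2 * \<alpha> * L * \<sigma>\<^sub>0 * (g (x 0) * u 0)
        + 2 * \<alpha> * L * \<sigma>\<^sub>0 * (u 0 * \<alpha>\<^sup>2 * (2 * L * \<sigma>\<^sub>0 + 2 + L / 2)) * ?K + \<alpha> * \<sigma>\<^sub>1 * u 0"
  proof -
    \<comment> \<open>This value lets the correlation error consume a third of the descent \<open>3 / 4 * \<alpha> * \<zeta> k\<close>.\<close>
    define \<epsilon> where "\<epsilon> = 1 / (8 * L * \<sigma>\<^sub>0 + 8)"
    have Ls: "0 \<le> L * \<sigma>\<^sub>0" using L_pos \<sigma>0_nonneg by simp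
    have \<epsilon>: "0 < \<epsilon>" "1 / (4 * \<epsilon>) = 2 * L * \<sigma>\<^sub>0 + 2" "2 * L * \<sigma>\<^sub>0 * \<epsilon> \<le> 1 / 4"
      using Ls by (auto simp: \<epsilon>_def field_simps)
    have Z: "0 \<le> ?Z" by (intro sum_nonneg) (simp add: \<zeta>_nonneg)
    have "2 * L * \<sigma>\<^sub>0 * ?B
        \<le> 2 * L * \<sigma>\<^sub>0 * (g (x 0) * u 0 + \<epsilon> * ?Z + u 0 * \<alpha>\<^sup>2 * (2 * L * \<sigma>\<^sub>0 + 2 + L / 2) * ?K)"
      using Ls sum_g_\<Delta>[OF \<epsilon>(1), of n] by (intro mult_left_mono) (auto simp: \<epsilon>(2))
    also have "\<dots> = (2 * L * \<sigma>\<^sub>0 * \<epsilon>) * ?Z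
        + 2 * L * \<sigma>\<^sub>0 * (g (x 0) * u 0 + u 0 * \<alpha>\<^sup>2 * (2 * L * \<sigma>\<^sub>0 + 2 + L / 2) * ?K)"
      by (simp add: algebra_simps)
    also have "(2 * L * \<sigma>\<^sub>0 * \<epsilon>) * ?Z \<le> 1 / 4 * ?Z"
      using \<epsilon>(3) Z by (rule mult_right_mono)
    finally have "2 * L * \<sigma>\<^sub>0 * ?B \<le> 1 / 4 * ?Z
        + 2 * L * \<sigma>\<^sub>0 * (g (x 0) * u 0 + u 0 * \<alpha>\<^sup>2 * (2 * L * \<sigma>\<^sub>0 + 2 + L / 2) * ?K)" by simp
    moreover have "\<sigma>\<^sub>1 * (\<Sum>k<n. \<Delta> k) \<le> \<sigma>\<^sub>1 * u 0"
      using sum_\<Delta>[of n] \<sigma>1_pos by (intro mult_left_mono) auto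
    ultimately have sum_le: "2 * L * \<sigma>\<^sub>0 * ?B + \<sigma>\<^sub>1 * (\<Sum>k<n. \<Delta> k) \<le> (1 / 4 * ?Z
        + 2 * L * \<sigma>\<^sub>0 * (g (x 0) * u 0 + u 0 * \<alpha>\<^sup>2 * (2 * L * \<sigma>\<^sub>0 + 2 + L / 2) * ?K)) + \<sigma>\<^sub>1 * u 0"
      by (rule add_mono)
    have "\<alpha> * (2 * L * \<sigma>\<^sub>0 * ?B + \<sigma>\<^sub>1 * (\<Sum>k<n. \<Delta> k)) \<le> \<alpha> * ((1 / 4 * ?Z
        + 2 * L * \<sigma>\<^sub>0 * (g (x 0) * u 0 + u 0 * \<alpha>\<^sup>2 * (2 * L * \<sigma>\<^sub>0 + 2 + L / 2) * ?K)) + \<sigma>\<^sub>1 * u 0)"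
      using \<alpha>_pos by (intro mult_left_mono[OF sum_le]) simp
    then show ?thesis by (simp add: algebra_simps)
  qed
  finally have "g (x n) + \<alpha> / 2 * ?Z \<le> (\<Sum>k<n. d k)
      + (g (x 0) * (1 + 2 * \<alpha> * L * \<sigma>\<^sub>0 * u 0) + \<alpha> * \<sigma>\<^sub>1 * u 0)
      + (2 * \<alpha> * L * \<sigma>\<^sub>0 * (u 0 * \<alpha>\<^sup>2 * (2 * L * \<sigma>\<^sub>0 + 2 + L / 2)) + L * \<alpha>\<^sup>2 / 2) * ?K"
    (is "_ \<le> _ + ?p + ?q * ?K") by (simp add: algebra_simps)
  moreover have "?p + ?q * ?K \<le> (?p + ?q) * (1 + ?K)"
  proof -
    have "0 \<le> ?K" by (intro sum_nonneg) (simp add: \<Gamma>_nonneg)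
    moreover have "0 \<le> ?p" "0 \<le> ?q"
      using nonneg[of "x 0"] \<alpha>_pos L_pos \<sigma>0_nonneg \<sigma>1_pos u_pos[of 0] by auto
    ultimately have "0 \<le> ?q + ?p * ?K" by simp
    then show ?thesis by (simp only: algebra_simps)
  qed
  ultimately show ?thesis unfolding drift_const_def by linarith
qed

text \<open>
  By \<open>norm_gradient_le\<close>, the square of the inner product is of order \<open>g (x k) * \<Gamma> k\<close>, and
  the square of the correction is of order \<open>(g (x k))\<^sup>2 * \<Delta> k + \<Delta> k\<close>. Once one factor
  \<open>g (x k)\<close> is bounded by \<open>R\<close>, what remains is summable, and \<open>R\<^sup>2\<close> only enters with the
  factor \<open>\<epsilon>\<close> from \<open>sum_g_\<Delta>\<close>.
\<close>

lemma sum_Y_squares: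
  assumes R: "\<And>k. k < n \<Longrightarrow> g (x k) \<le> R" and Z: "(\<Sum>k<n. \<zeta> k) \<le> 2 / \<alpha> * R"
    and "0 \<le> R" "0 < \<epsilon>"
  shows "(\<Sum>k<n. (Y k)\<^sup>2) \<le> 4 * \<alpha>\<^sup>2 * L * R * (\<Sum>k<n. \<Gamma> k)
    + 16 * \<alpha>\<^sup>2 * L\<^sup>2 * \<sigma>\<^sub>0\<^sup>2 * u 0 * R * (g (x 0) * u 0 + \<epsilon> * (2 / \<alpha> * R)
        + u 0 * \<alpha>\<^sup>2 * (1 / (4 * \<epsilon>) + L / 2) * (\<Sum>k<n. \<Gamma> k))
    + 4 * \<alpha>\<^sup>2 * \<sigma>\<^sub>1\<^sup>2 * (u 0)\<^sup>2"
proof -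
  let ?K = "\<Sum>k<n. \<Gamma> k" and ?B = "\<Sum>k<n. g (x k) * \<Delta> k"
  have sq: "(a + b)\<^sup>2 \<le> 2 * a\<^sup>2 + 2 * b\<^sup>2" for a b :: real
    using zero_le_power2[of "a - b"] by (simp add: power2_eq_square algebra_simps)
  have one: "(Y k)\<^sup>2 \<le> 4 * \<alpha>\<^sup>2 * L * R * \<Gamma> k
      + 16 * \<alpha>\<^sup>2 * L\<^sup>2 * \<sigma>\<^sub>0\<^sup>2 * u 0 * R * (g (x k) * \<Delta> k) + 4 * \<alpha>\<^sup>2 * \<sigma>\<^sub>1\<^sup>2 * u 0 * \<Delta> k" if "k < n" for k
  proof -
    have "(Y k)\<^sup>2 = \<alpha>\<^sup>2 * (inner (dg (x k)) (\<gamma> k) * u (Suc k) + v k * \<Delta> k)\<^sup>2"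
      by (simp add: Y_def power2_eq_square algebra_simps)
    also have "\<dots> \<le> \<alpha>\<^sup>2 * (2 * (2 * L * R * \<Gamma> k) + 2 * (u 0 * \<Delta> k * (8 * L\<^sup>2 * \<sigma>\<^sub>0\<^sup>2 * (R * g (x k)) + 2 * \<sigma>\<^sub>1\<^sup>2)))"
    proof (intro mult_left_mono order_trans[OF sq] add_mono)
      have "(inner (dg (x k)) (\<gamma> k) * u (Suc k))\<^sup>2 = (inner (dg (x k)) (\<gamma> k))\<^sup>2 * (u (Suc k))\<^sup>2"
        by (simp add: power_mult_distrib)
      also have "\<dots> \<le> ((norm (dg (x k)))\<^sup>2 * (norm (\<gamma> k))\<^sup>2) * (u (Suc k))\<^sup>2"
        using Cauchy_Schwarz_ineq[of "dg (x k)" "\<gamma> k"]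
        by (intro mult_right_mono) (auto simp: power2_norm_eq_inner)
      also have "\<dots> = (norm (dg (x k)))\<^sup>2 * \<Gamma> k"
        by (simp add: \<Gamma>_eq power_mult_distrib)
      also have "\<dots> \<le> (2 * L * R) * \<Gamma> k"
        using norm_gradient_le[of "x k"] R[OF that] L_pos \<Gamma>_nonneg[of k]
        by (intro mult_right_mono) (auto intro: order_trans)
      finally show "(inner (dg (x k)) (\<gamma> k) * u (Suc k))\<^sup>2 \<le> 2 * L * R * \<Gamma> k" .
      have "(v k)\<^sup>2 \<le> (2 * L * \<sigma>\<^sub>0 * g (x k) + \<sigma>\<^sub>1)\<^sup>2"
        using v_le[of k] v_pos[of k] by (intro power_mono) auto
      also have "\<dots> \<le> 2 * (2 * L * \<sigma>\<^sub>0 * g (x k))\<^sup>2 + 2 * \<sigma>\<^sub>1\<^sup>2" by (rule sq)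
      also have "(2 * L * \<sigma>\<^sub>0 * g (x k))\<^sup>2 = 4 * L\<^sup>2 * \<sigma>\<^sub>0\<^sup>2 * (g (x k) * g (x k))"
        by (simp add: power2_eq_square)
      also have "\<dots> \<le> 4 * L\<^sup>2 * \<sigma>\<^sub>0\<^sup>2 * (R * g (x k))"
        using R[OF that] nonneg[of "x k"] by (intro mult_left_mono mult_right_mono) auto
      finally have v2: "(v k)\<^sup>2 \<le> 8 * L\<^sup>2 * \<sigma>\<^sub>0\<^sup>2 * (R * g (x k)) + 2 * \<sigma>\<^sub>1\<^sup>2" by simp
      have "(v k * \<Delta> k)\<^sup>2 = (\<Delta> k * \<Delta> k) * (v k)\<^sup>2" by (simp add: power2_eq_square)
      also have "\<dots> \<le> (u 0 * \<Delta> k) * (8 * L\<^sup>2 * \<sigma>\<^sub>0\<^sup>2 * (R * g (x k)) + 2 * \<sigma>\<^sub>1\<^sup>2)"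
        using \<Delta>_le0[of k] \<Delta>_nonneg[of k] u_pos[of 0] v2 by (intro mult_mono mult_right_mono) auto
      finally show "(v k * \<Delta> k)\<^sup>2 \<le> u 0 * \<Delta> k * (8 * L\<^sup>2 * \<sigma>\<^sub>0\<^sup>2 * (R * g (x k)) + 2 * \<sigma>\<^sub>1\<^sup>2)" .
    qed auto
    finally show ?thesis by (simp add: algebra_simps)
  qed
  have "(\<Sum>k<n. (Y k)\<^sup>2) \<le> (\<Sum>k<n. 4 * \<alpha>\<^sup>2 * L * R * \<Gamma> k
      + 16 * \<alpha>\<^sup>2 * L\<^sup>2 * \<sigma>\<^sub>0\<^sup>2 * u 0 * R * (g (x k) * \<Delta> k) + 4 * \<alpha>\<^sup>2 * \<sigma>\<^sub>1\<^sup>2 * u 0 * \<Delta> k)"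
    by (rule sum_mono) (use one in auto)
  also have "\<dots> = 4 * \<alpha>\<^sup>2 * L * R * ?K + 16 * \<alpha>\<^sup>2 * L\<^sup>2 * \<sigma>\<^sub>0\<^sup>2 * u 0 * R * ?B + 4 * \<alpha>\<^sup>2 * \<sigma>\<^sub>1\<^sup>2 * u 0 * (\<Sum>k<n. \<Delta> k)"
    by (simp only: sum.distrib sum_distrib_left)
  also have "\<dots> \<le> 4 * \<alpha>\<^sup>2 * L * R * ?K
    + 16 * \<alpha>\<^sup>2 * L\<^sup>2 * \<sigma>\<^sub>0\<^sup>2 * u 0 * R * (g (x 0) * u 0 + \<epsilon> * (2 / \<alpha> * R)
        + u 0 * \<alpha>\<^sup>2 * (1 / (4 * \<epsilon>) + L / 2) * ?K) + 4 * \<alpha>\<^sup>2 * \<sigma>\<^sub>1\<^sup>2 * u 0 * u 0"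
  proof (intro add_mono mult_left_mono order_refl sum_\<Delta>)
    show "?B \<le> g (x 0) * u 0 + \<epsilon> * (2 / \<alpha> * R) + u 0 * \<alpha>\<^sup>2 * (1 / (4 * \<epsilon>) + L / 2) * ?K"
      using sum_g_\<Delta>[OF assms(4), of n] mult_left_mono[OF Z, of \<epsilon>] assms(4) by simp
  qed (use assms(3) u_pos[of 0] L_pos in auto)
  finally show ?thesis by (simp add: power2_eq_square mult_ac)
qed

end

section \<open>Martingales with essentially bounded increments\<close>

context prob_space
begin

text \<open>
  Boundedness almost everywhere is what conditional expectations of bounded functions inherit. It
  makes all products in the martingale computations integrable.
\<close>

definition ess_bdd :: "('a \<Rightarrow> real) \<Rightarrow> bool"
  where "ess_bdd f \<longleftrightarrow> f \<in> borel_measurable M \<and> (\<exists>B. AE \<omega> in M. \<bar>f \<omega>\<bar> \<le> B)"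

lemma ess_bddI:
  assumes "f \<in> borel_measurable M" and "AE \<omega> in M. \<bar>f \<omega>\<bar> \<le> B"
  shows "ess_bdd f"
  using assms by (auto simp: ess_bdd_def)

lemma ess_bdd_measurable: "ess_bdd f \<Longrightarrow> f \<in> borel_measurable M"
  by (simp add: ess_bdd_def)

lemma ess_bdd_integrable: "ess_bdd f \<Longrightarrow> integrable M f"
  by (auto simp: ess_bdd_def intro: integrable_const_bound[of f, unfolded real_norm_def])

lemma ess_bdd_const: "ess_bdd (\<lambda>_. c)"
  by (rule ess_bddI[of _ "\<bar>c\<bar>"]) auto

lemma ess_bdd_add:
  assumes "ess_bdd f" "ess_bdd h"
  shows "ess_bdd (\<lambda>\<omega>. f \<omega> + h \<omega>)"
proof -
  obtain B C where "AE \<omega> in M. \<bar>f \<omega>\<bar> \<le> B" "AE \<omega> in M. \<bar>h \<omega>\<bar> \<le> C"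
    using assms by (auto simp: ess_bdd_def)
  then have "AE \<omega> in M. \<bar>f \<omega> + h \<omega>\<bar> \<le> B + C" by eventually_elim linarith
  with assms show ?thesis by (intro ess_bddI) (auto simp: ess_bdd_def)
qed

lemma ess_bdd_mult:
  assumes "ess_bdd f" "ess_bdd h"
  shows "ess_bdd (\<lambda>\<omega>. f \<omega> * h \<omega>)"
proof -
  obtain B C where "AE \<omega> in M. \<bar>f \<omega>\<bar> \<le> B" "AE \<omega> in M. \<bar>h \<omega>\<bar> \<le> C"
    using assms by (auto simp: ess_bdd_def)
  then have "AE \<omega> in M. \<bar>f \<omega> * h \<omega>\<bar> \<le> \<bar>B\<bar> * \<bar>C\<bar>"
    by eventually_elim (auto simp: abs_mult intro!: mult_mono)
  with assms show ?thesis by (intro ess_bddI) (auto simp: ess_bdd_def)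
qed

lemma ess_bdd_diff:
  assumes "ess_bdd f" "ess_bdd h"
  shows "ess_bdd (\<lambda>\<omega>. f \<omega> - h \<omega>)"
  using ess_bdd_add[OF assms(1) ess_bdd_mult[OF ess_bdd_const[of "- 1"] assms(2)]] by simp

lemma ess_bdd_square: "ess_bdd f \<Longrightarrow> ess_bdd (\<lambda>\<omega>. (f \<omega>)\<^sup>2)"
  by (simp add: power2_eq_square ess_bdd_mult)

lemma ess_bdd_sum: "(\<And>i. i \<in> I \<Longrightarrow> ess_bdd (f i)) \<Longrightarrow> ess_bdd (\<lambda>\<omega>. \<Sum>i\<in>I. f i \<omega>)"
  by (induction I rule: infinite_finite_induct) (auto intro: ess_bdd_const ess_bdd_add)

lemma ess_bdd_max:
  assumes "ess_bdd f" "ess_bdd h"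
  shows "ess_bdd (\<lambda>\<omega>. max (f \<omega>) (h \<omega>))"
proof -
  obtain B C where "AE \<omega> in M. \<bar>f \<omega>\<bar> \<le> B" "AE \<omega> in M. \<bar>h \<omega>\<bar> \<le> C"
    using assms by (auto simp: ess_bdd_def)
  then have "AE \<omega> in M. \<bar>max (f \<omega>) (h \<omega>)\<bar> \<le> max B C" by eventually_elim linarith
  with assms show ?thesis by (intro ess_bddI) (auto simp: ess_bdd_def)
qed

end

locale bounded_martingale = prob_space M for M :: "'w measure" +
  fixes F :: "nat \<Rightarrow> 'w measure" and d :: "nat \<Rightarrow> 'w \<Rightarrow> real"
  assumes filtration_mono: "\<And>n. subalgebra (F (Suc n)) (F n)"
    and increment_adapted: "\<And>n. d n \<in> borel_measurable (F (Suc n))"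
    and increment_bounded: "\<And>n. ess_bdd (d n)"
    and increment_orthogonal: "\<And>n X. X \<in> borel_measurable (F n) \<Longrightarrow> ess_bdd X \<Longrightarrow>
      expectation (\<lambda>\<omega>. X \<omega> * d n \<omega>) = 0"
begin

definition W :: "nat \<Rightarrow> 'w \<Rightarrow> real" where "W n \<omega> = (\<Sum>k<n. d k \<omega>)"
definition W_max :: "nat \<Rightarrow> 'w \<Rightarrow> real" where "W_max n \<omega> = Max ((\<lambda>m. W m \<omega>) ` {..n})"

lemma W_0: "W 0 \<omega> = 0"
  by (simp add: W_def)

lemma W_Suc: "W (Suc n) \<omega> = W n \<omega> + d n \<omega>"
  by (simp add: W_def)

lemma W_max_0: "W_max 0 \<omega> = 0"
  by (simp add: W_max_def W_0)

lemma W_max_Suc: "W_max (Suc n) \<omega> = max (W (Suc n) \<omega>) (W_max n \<omega>)"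
  by (simp add: W_max_def atMost_Suc)

lemma W_le_W_max: "m \<le> n \<Longrightarrow> W m \<omega> \<le> W_max n \<omega>"
  by (simp add: W_max_def)

lemma W_max_nonneg: "0 \<le> W_max n \<omega>"
  using W_le_W_max[of 0 n \<omega>] by (simp add: W_0)

lemma W_adapted: "W n \<in> borel_measurable (F n)"
proof (induction n)
  case (Suc n)
  have "W n \<in> borel_measurable (F (Suc n))"
    using measurable_from_subalg[OF filtration_mono Suc] .
  then show ?case using increment_adapted[of n] by (simp add: W_Suc[abs_def])
qed (simp add: W_0[abs_def])

lemma W_max_adapted: "W_max n \<in> borel_measurable (F n)"
proof (induction n)
  case (Suc n)
  have "W_max n \<in> borel_measurable (F (Suc n))"
    using measurable_from_subalg[OF filtration_mono Suc] .
  then show ?case using W_adapted[of "Suc n"] by (simp add: W_max_Suc[abs_def])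
qed (simp add: W_max_0[abs_def])

lemma ess_bdd_W: "ess_bdd (W n)"
  unfolding W_def[abs_def] by (intro ess_bdd_sum increment_bounded)

lemma ess_bdd_W_max: "ess_bdd (W_max n)"
  by (induction n) (auto simp: W_max_0[abs_def] W_max_Suc[abs_def] intro: ess_bdd_const ess_bdd_max ess_bdd_W)

lemma expectation_W_square: "expectation (\<lambda>\<omega>. (W n \<omega>)\<^sup>2) = (\<Sum>k<n. expectation (\<lambda>\<omega>. (d k \<omega>)\<^sup>2))"
proof (induction n)
  case (Suc n)
  note bdd = ess_bdd_square[OF ess_bdd_W[of n]] ess_bdd_square[OF increment_bounded[of n]]
    ess_bdd_mult[OF ess_bdd_W[of n] increment_bounded[of n]]
  have "expectation (\<lambda>\<omega>. (W (Suc n) \<omega>)\<^sup>2)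
      = expectation (\<lambda>\<omega>. (W n \<omega>)\<^sup>2 + 2 * (W n \<omega> * d n \<omega>) + (d n \<omega>)\<^sup>2)"
    by (simp add: W_Suc power2_eq_square algebra_simps)
  also have "\<dots> = expectation (\<lambda>\<omega>. (W n \<omega>)\<^sup>2) + 2 * expectation (\<lambda>\<omega>. W n \<omega> * d n \<omega>)
      + expectation (\<lambda>\<omega>. (d n \<omega>)\<^sup>2)"
    using bdd[THEN ess_bdd_integrable] by simp
  also have "expectation (\<lambda>\<omega>. W n \<omega> * d n \<omega>) = 0"
    by (rule increment_orthogonal[OF W_adapted ess_bdd_W])
  finally show ?case using Suc by simp
qed (simp add: W_0)

text \<open>
  Summation by parts: the running maximum only grows where it equals \<open>W\<close>, so that
  \<open>W_max n * W n\<close> minus the martingale transform of \<open>W_max\<close> is a sum of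
  \<open>W_max (Suc k) * (W_max (Suc k) - W_max k)\<close>, which dominates half of the telescoping squares.
\<close>

lemma pathwise_maximal_inequality:
  "(W_max n \<omega>)\<^sup>2 / 2 \<le> W_max n \<omega> * W n \<omega> - (\<Sum>k<n. W_max k \<omega> * d k \<omega>)"
proof (induction n)
  case (Suc n)
  show ?case
  proof (cases "W (Suc n) \<omega> \<le> W_max n \<omega>")
    case True
    then show ?thesis using Suc by (simp add: W_max_Suc max_def W_Suc algebra_simps)
  next
    case False
    then have "W_max (Suc n) \<omega> = W (Suc n) \<omega>" by (simp add: W_max_Suc)
    moreover have "0 \<le> (W (Suc n) \<omega> - W_max n \<omega>)\<^sup>2" by simp
    ultimately show ?thesis using Suc by (simp add: W_Suc power2_eq_square field_simps)
  qed
qed (simp add: W_max_0)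

text \<open>
  Doob's \<open>L\<^sup>2\<close> inequality: the martingale transform in the pathwise inequality has mean zero.
\<close>

proposition expectation_W_max_square:
  "expectation (\<lambda>\<omega>. (W_max n \<omega>)\<^sup>2) \<le> 4 * (\<Sum>k<n. expectation (\<lambda>\<omega>. (d k \<omega>)\<^sup>2))"
proof -
  have transform: "ess_bdd (\<lambda>\<omega>. W_max k \<omega> * d k \<omega>)" for k
    by (intro ess_bdd_mult ess_bdd_W_max increment_bounded)
  note int = ess_bdd_integrable[OF transform] ess_bdd_integrable[OF ess_bdd_square[OF ess_bdd_W[of n]]]
    ess_bdd_integrable[OF ess_bdd_square[OF ess_bdd_W_max[of n]]]
  have "expectation (\<lambda>\<omega>. (W_max n \<omega>)\<^sup>2 / 2)
      \<le> expectation (\<lambda>\<omega>. (W_max n \<omega>)\<^sup>2 / 4 + (W n \<omega>)\<^sup>2 - (\<Sum>k<n. W_max k \<omega> * d k \<omega>))"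
  proof (rule integral_mono)
    fix \<omega>
    have "0 \<le> (W_max n \<omega> / 2 - W n \<omega>)\<^sup>2" by simp
    then have "W_max n \<omega> * W n \<omega> \<le> (W_max n \<omega>)\<^sup>2 / 4 + (W n \<omega>)\<^sup>2"
      by (simp add: power2_eq_square field_simps)
    then show "(W_max n \<omega>)\<^sup>2 / 2 \<le> (W_max n \<omega>)\<^sup>2 / 4 + (W n \<omega>)\<^sup>2 - (\<Sum>k<n. W_max k \<omega> * d k \<omega>)"
      using pathwise_maximal_inequality[of n \<omega>] by linarith
  qed (use int in auto)
  also have "\<dots> = expectation (\<lambda>\<omega>. (W_max n \<omega>)\<^sup>2) / 4 + expectation (\<lambda>\<omega>. (W n \<omega>)\<^sup>2)
      - (\<Sum>k<n. expectation (\<lambda>\<omega>. W_max k \<omega> * d k \<omega>))"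
    using int by simp
  also have "(\<Sum>k<n. expectation (\<lambda>\<omega>. W_max k \<omega> * d k \<omega>)) = 0"
    by (intro sum.neutral ballI increment_orthogonal W_max_adapted ess_bdd_W_max)
  finally show ?thesis by (simp add: expectation_W_square)
qed

end

section \<open>The stochastic process\<close>

text \<open>
  The filtration is shifted along with the indices: \<open>x n\<close> and \<open>s n\<close> are known at time \<open>n\<close>, and \<open>\<gamma> n\<close>
  at time \<open>Suc n\<close>.
\<close>

locale adagrad_process = prob_space M + smooth_nonneg g dg L
  for M :: "'w measure" and g :: "'a :: euclidean_space \<Rightarrow> real" and dg :: "'a \<Rightarrow> 'a" and L :: real +
  fixes F :: "nat \<Rightarrow> 'w measure" and x \<gamma> :: "nat \<Rightarrow> 'w \<Rightarrow> 'a" and s :: "nat \<Rightarrow> 'w \<Rightarrow> real"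
    and \<alpha> \<sigma>\<^sub>0 \<sigma>\<^sub>1 :: real and x\<^sub>0 :: 'a and s\<^sub>0 :: real
  assumes \<alpha>_pos: "0 < \<alpha>" and s\<^sub>0_pos: "0 < s\<^sub>0"
    and \<sigma>0_nonneg: "0 \<le> \<sigma>\<^sub>0" and \<sigma>1_pos: "0 < \<sigma>\<^sub>1"
    and x_0: "\<And>\<omega>. \<omega> \<in> space M \<Longrightarrow> x 0 \<omega> = x\<^sub>0"
    and s_0: "\<And>\<omega>. \<omega> \<in> space M \<Longrightarrow> s 0 \<omega> = s\<^sub>0"
    and s_Suc: "\<And>n \<omega>. \<omega> \<in> space M \<Longrightarrow> s (Suc n) \<omega> = s n \<omega> + (norm (\<gamma> n \<omega>))\<^sup>2"
    and x_Suc: "\<And>n \<omega>. \<omega> \<in> space M \<Longrightarrow> x (Suc n) \<omega> = x n \<omega> - (\<alpha> / sqrt (s (Suc n) \<omega>)) *\<^sub>R \<gamma> n \<omega>"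
    and subalg: "\<And>n. subalgebra M (F n)"
    and subalg_Suc: "\<And>n. subalgebra (F (Suc n)) (F n)"
    and \<gamma>_adapted: "\<And>n. \<gamma> n \<in> borel_measurable (F (Suc n))"
    and unbiased: "\<And>n b. b \<in> Basis \<Longrightarrow>
      AE \<omega> in M. real_cond_exp M (F n) (\<lambda>\<omega>. inner (\<gamma> n \<omega>) b) \<omega> = inner (dg (x n \<omega>)) b"
    and second_moment: "\<And>n. AE \<omega> in M. nn_cond_exp M (F n) (\<lambda>\<omega>. ennreal ((norm (\<gamma> n \<omega>))\<^sup>2)) \<omega>
      \<le> ennreal (\<sigma>\<^sub>0 * (norm (dg (x n \<omega>)))\<^sup>2 + \<sigma>\<^sub>1)"
begin

abbreviation u :: "nat \<Rightarrow> 'w \<Rightarrow> real"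
  where "u n \<omega> \<equiv> adagrad_quantities.u (\<lambda>k. s k \<omega>) n"
abbreviation \<Delta> :: "nat \<Rightarrow> 'w \<Rightarrow> real"
  where "\<Delta> n \<omega> \<equiv> adagrad_quantities.\<Delta> (\<lambda>k. s k \<omega>) n"
abbreviation \<Gamma> :: "nat \<Rightarrow> 'w \<Rightarrow> real"
  where "\<Gamma> n \<omega> \<equiv> adagrad_quantities.\<Gamma> (\<lambda>k. \<gamma> k \<omega>) (\<lambda>k. s k \<omega>) n"
abbreviation \<zeta> :: "nat \<Rightarrow> 'w \<Rightarrow> real"
  where "\<zeta> n \<omega> \<equiv> adagrad_quantities.\<zeta> dg (\<lambda>k. x k \<omega>) (\<lambda>k. s k \<omega>) n"
abbreviation v :: "nat \<Rightarrow> 'w \<Rightarrow> real"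
  where "v n \<omega> \<equiv> adagrad_quantities.v dg (\<lambda>k. x k \<omega>) \<sigma>\<^sub>0 \<sigma>\<^sub>1 n"
abbreviation Y :: "nat \<Rightarrow> 'w \<Rightarrow> real"
  where "Y n \<omega> \<equiv> adagrad_quantities.Y dg (\<lambda>k. x k \<omega>) (\<lambda>k. \<gamma> k \<omega>) (\<lambda>k. s k \<omega>) \<alpha> \<sigma>\<^sub>0 \<sigma>\<^sub>1 n"
abbreviation grad :: "nat \<Rightarrow> 'w \<Rightarrow> 'a"
  where "grad n \<omega> \<equiv> dg (x n \<omega>)"

lemmas quantity_defs = adagrad_quantities.u_def adagrad_quantities.\<Delta>_def adagrad_quantities.\<Gamma>_def
  adagrad_quantities.\<zeta>_def adagrad_quantities.v_def adagrad_quantities.Y_def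

lemma path:
  assumes "\<omega> \<in> space M"
  shows "adagrad_path g dg L (\<lambda>k. x k \<omega>) (\<lambda>k. \<gamma> k \<omega>) (\<lambda>k. s k \<omega>) \<alpha> \<sigma>\<^sub>0 \<sigma>\<^sub>1"
  by unfold_locales (use assms in \<open>auto simp: \<alpha>_pos \<sigma>0_nonneg \<sigma>1_pos s_0 s\<^sub>0_pos s_Suc x_Suc\<close>)

lemma sigma_finite_F: "sigma_finite_subalgebra M (F n)"
  by (intro finite_measure_subalgebra_is_sigma_finite finite_measure_subalgebra.intro
      finite_measure_axioms finite_measure_subalgebra_axioms.intro subalg)

lemma space_F: "space (F n) = space M"
  using subalg[of n] by (simp add: subalgebra_def)

lemma dg_measurable: "dg \<in> borel_measurable borel"
  by (rule borel_measurable_continuous_onI[OF continuous_gradient])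

lemma x_s_adapted: "x n \<in> borel_measurable (F n) \<and> s n \<in> borel_measurable (F n)"
proof (induction n)
  case 0
  have "x 0 \<in> borel_measurable (F 0) \<longleftrightarrow> (\<lambda>_. x\<^sub>0) \<in> borel_measurable (F 0)"
    by (rule measurable_cong) (simp add: space_F x_0)
  moreover have "s 0 \<in> borel_measurable (F 0) \<longleftrightarrow> (\<lambda>_. s\<^sub>0) \<in> borel_measurable (F 0)"
    by (rule measurable_cong) (simp add: space_F s_0)
  ultimately show ?case by simp
next
  case (Suc n)
  have [measurable]: "x n \<in> borel_measurable (F (Suc n))" "s n \<in> borel_measurable (F (Suc n))"
    using Suc measurable_from_subalg[OF subalg_Suc] by auto
  note [measurable] = \<gamma>_adapted[of n]
  have "s (Suc n) \<in> borel_measurable (F (Suc n)) \<longleftrightarrow>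
      (\<lambda>\<omega>. s n \<omega> + (norm (\<gamma> n \<omega>))\<^sup>2) \<in> borel_measurable (F (Suc n))"
    by (rule measurable_cong) (simp add: space_F s_Suc)
  then have s[measurable]: "s (Suc n) \<in> borel_measurable (F (Suc n))" by simp
  have "x (Suc n) \<in> borel_measurable (F (Suc n)) \<longleftrightarrow>
      (\<lambda>\<omega>. x n \<omega> - (\<alpha> / sqrt (s (Suc n) \<omega>)) *\<^sub>R \<gamma> n \<omega>) \<in> borel_measurable (F (Suc n))"
    by (rule measurable_cong) (simp add: space_F x_Suc)
  with s show ?case by simp
qed

lemma x_adapted: "x n \<in> borel_measurable (F n)" and s_adapted: "s n \<in> borel_measurable (F n)"
  using x_s_adapted by auto

lemma grad_adapted: "grad n \<in> borel_measurable (F n)"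
  by (rule measurable_compose[OF x_adapted dg_measurable])

lemma u_adapted: "u n \<in> borel_measurable (F n)"
  using s_adapted[of n] by (simp add: quantity_defs)

lemma v_adapted: "v n \<in> borel_measurable (F n)"
  using grad_adapted[of n] by (simp add: quantity_defs)

lemma \<zeta>_adapted: "\<zeta> n \<in> borel_measurable (F n)"
  using grad_adapted[of n] s_adapted[of n] by (simp add: quantity_defs)

lemma \<Gamma>_adapted: "\<Gamma> n \<in> borel_measurable (F (Suc n))"
  using \<gamma>_adapted[of n] s_adapted[of "Suc n"] by (simp add: quantity_defs)

lemma Y_adapted: "Y n \<in> borel_measurable (F (Suc n))"
proof -
  have [measurable]: "grad n \<in> borel_measurable (F (Suc n))" "s n \<in> borel_measurable (F (Suc n))"
    by (rule measurable_from_subalg[OF subalg_Suc], rule grad_adapted s_adapted)+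
  note [measurable] = \<gamma>_adapted[of n] s_adapted[of "Suc n"]
  show ?thesis by (simp add: quantity_defs)
qed

lemmas measurable_M = measurable_from_subalg[OF subalg]

text \<open>
  The iterates travel at most \<open>\<alpha>\<close> per step, so that everything but the gradient samples and the
  accumulators is bounded at each time.
\<close>

definition grad_bound :: "nat \<Rightarrow> real" where "grad_bound n = norm (dg x\<^sub>0) + L * (\<alpha> * real n)"

lemma grad_bound_nonneg: "0 \<le> grad_bound n"
  using L_pos \<alpha>_pos by (simp add: grad_bound_def)

lemma norm_grad_le:
  assumes "\<omega> \<in> space M"
  shows "norm (grad n \<omega>) \<le> grad_bound n"
proof -
  interpret P: adagrad_path g dg L "\<lambda>k. x k \<omega>" "\<lambda>k. \<gamma> k \<omega>" "\<lambda>k. s k \<omega>" \<alpha> \<sigma>\<^sub>0 \<sigma>\<^sub>1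
    by (rule path[OF assms])
  have "norm (grad n \<omega>) \<le> norm (dg x\<^sub>0) + norm (grad n \<omega> - dg x\<^sub>0)"
    using norm_triangle_ineq[of "dg x\<^sub>0" "grad n \<omega> - dg x\<^sub>0"] by simp
  also have "norm (grad n \<omega> - dg x\<^sub>0) \<le> L * norm (x n \<omega> - x\<^sub>0)"
    by (rule lipschitz)
  also have "\<dots> \<le> L * (\<alpha> * real n)"
    using P.dist_start[of n] L_pos by (intro mult_left_mono) (simp_all add: x_0[OF assms])
  finally show ?thesis by (simp add: grad_bound_def)
qed

lemma ess_bdd_norm_grad: "ess_bdd (\<lambda>\<omega>. norm (grad n \<omega>))"
  using measurable_M[OF grad_adapted] norm_grad_le
  by (intro ess_bddI[of _ "grad_bound n"]) auto

lemma ess_bdd_u: "ess_bdd (u n)"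
proof (rule ess_bddI[OF measurable_M[OF u_adapted]])
  have "\<bar>u n \<omega>\<bar> \<le> 1 / sqrt s\<^sub>0" if "\<omega> \<in> space M" for \<omega>
  proof -
    interpret P: adagrad_path g dg L "\<lambda>k. x k \<omega>" "\<lambda>k. \<gamma> k \<omega>" "\<lambda>k. s k \<omega>" \<alpha> \<sigma>\<^sub>0 \<sigma>\<^sub>1
      by (rule path[OF that])
    show ?thesis using P.u_antimono[of 0 n] P.u_pos[of n] by (simp add: P.u_def s_0[OF that])
  qed
  then show "AE \<omega> in M. \<bar>u n \<omega>\<bar> \<le> 1 / sqrt s\<^sub>0" by simp
qed

lemma ess_bdd_\<Gamma>: "ess_bdd (\<Gamma> n)"
proof (rule ess_bddI[OF measurable_M[OF \<Gamma>_adapted]])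
  have "\<bar>\<Gamma> n \<omega>\<bar> \<le> 1" if "\<omega> \<in> space M" for \<omega>
  proof -
    interpret P: adagrad_path g dg L "\<lambda>k. x k \<omega>" "\<lambda>k. \<gamma> k \<omega>" "\<lambda>k. s k \<omega>" \<alpha> \<sigma>\<^sub>0 \<sigma>\<^sub>1
      by (rule path[OF that])
    show ?thesis using P.\<Gamma>_nonneg[of n] P.\<Gamma>_le1[of n] by simp
  qed
  then show "AE \<omega> in M. \<bar>\<Gamma> n \<omega>\<bar> \<le> 1" by simp
qed

lemma ess_bdd_v: "ess_bdd (v n)"
  unfolding quantity_defs
  by (intro ess_bdd_add ess_bdd_mult ess_bdd_const ess_bdd_square ess_bdd_norm_grad)

lemma ess_bdd_\<zeta>: "ess_bdd (\<zeta> n)"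
  unfolding adagrad_quantities.\<zeta>_def
  by (intro ess_bdd_mult ess_bdd_square ess_bdd_norm_grad ess_bdd_u)

lemma ess_bdd_Y: "ess_bdd (Y n)"
proof -
  have "ess_bdd (\<lambda>\<omega>. inner (grad n \<omega>) (\<gamma> n \<omega>) * u (Suc n) \<omega>)"
  proof (rule ess_bddI)
    note [measurable] = measurable_M[OF grad_adapted] measurable_M[OF \<gamma>_adapted] measurable_M[OF u_adapted]
    show "(\<lambda>\<omega>. inner (grad n \<omega>) (\<gamma> n \<omega>) * u (Suc n) \<omega>) \<in> borel_measurable M" by measurable
    have "\<bar>inner (grad n \<omega>) (\<gamma> n \<omega>) * u (Suc n) \<omega>\<bar> \<le> grad_bound n" if "\<omega> \<in> space M" for \<omega>
    proof -
      interpret P: adagrad_path g dg L "\<lambda>k. x k \<omega>" "\<lambda>k. \<gamma> k \<omega>" "\<lambda>k. s k \<omega>" \<alpha> \<sigma>\<^sub>0 \<sigma>\<^sub>1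
        by (rule path[OF that])
      have "\<bar>inner (grad n \<omega>) (\<gamma> n \<omega>) * P.u (Suc n)\<bar> \<le> (norm (grad n \<omega>) * norm (\<gamma> n \<omega>)) * P.u (Suc n)"
        using P.u_pos[of "Suc n"] Cauchy_Schwarz_ineq2[of "grad n \<omega>" "\<gamma> n \<omega>"]
        by (simp add: abs_mult mult_right_mono)
      also have "\<dots> = norm (grad n \<omega>) * sqrt (P.\<Gamma> n)" by (simp add: P.sqrt_\<Gamma>)
      also have "\<dots> \<le> grad_bound n * 1"
        using norm_grad_le[OF that, of n] P.\<Gamma>_le1[of n] P.\<Gamma>_nonneg[of n] grad_bound_nonneg[of n]
        by (intro mult_mono) auto
      finally show ?thesis by simp
    qed
    then show "AE \<omega> in M. \<bar>inner (grad n \<omega>) (\<gamma> n \<omega>) * u (Suc n) \<omega>\<bar> \<le> grad_bound n" by simp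
  qed
  moreover have "ess_bdd (\<Delta> n)"
    unfolding adagrad_quantities.\<Delta>_def by (intro ess_bdd_diff ess_bdd_u)
  ultimately have "ess_bdd (\<lambda>\<omega>. (- \<alpha>) * (inner (grad n \<omega>) (\<gamma> n \<omega>) * u (Suc n) \<omega>) - \<alpha> * (v n \<omega> * \<Delta> n \<omega>))"
    by (intro ess_bdd_diff ess_bdd_mult[OF ess_bdd_const] ess_bdd_mult[OF ess_bdd_v])
  then show ?thesis by (simp add: adagrad_quantities.Y_def mult.assoc)
qed

section \<open>Conditional moments of the gradient samples\<close>

lemma norm_\<gamma>_square_integrable: "integrable M (\<lambda>\<omega>. (norm (\<gamma> n \<omega>))\<^sup>2)"
proof (rule integrableI_nonneg)
  interpret sigma_finite_subalgebra M "F n" by (rule sigma_finite_F)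
  note [measurable] = measurable_M[OF \<gamma>_adapted, of n]
  show "(\<lambda>\<omega>. (norm (\<gamma> n \<omega>))\<^sup>2) \<in> borel_measurable M" by measurable
  have "(\<integral>\<^sup>+\<omega>. ennreal ((norm (\<gamma> n \<omega>))\<^sup>2) \<partial>M)
      = (\<integral>\<^sup>+\<omega>. nn_cond_exp M (F n) (\<lambda>\<omega>. ennreal ((norm (\<gamma> n \<omega>))\<^sup>2)) \<omega> \<partial>M)"
    using nn_cond_exp_intg[of "\<lambda>_. 1" "\<lambda>\<omega>. ennreal ((norm (\<gamma> n \<omega>))\<^sup>2)"] by simp
  also have "\<dots> \<le> (\<integral>\<^sup>+\<omega>. ennreal (v n \<omega>) \<partial>M)"
    using second_moment[of n] by (intro nn_integral_mono_AE) (simp add: adagrad_quantities.v_def)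
  also have "\<dots> < \<infinity>"
    using ess_bdd_integrable[OF ess_bdd_v[of n]] \<sigma>0_nonneg \<sigma>1_pos
    by (subst nn_integral_eq_integral) (auto simp: adagrad_quantities.v_def)
  finally show "(\<integral>\<^sup>+\<omega>. ennreal ((norm (\<gamma> n \<omega>))\<^sup>2) \<partial>M) < \<infinity>" .
qed auto

lemma weighted_norm_\<gamma>_square_integrable:
  assumes "ess_bdd X"
  shows "integrable M (\<lambda>\<omega>. X \<omega> * (norm (\<gamma> n \<omega>))\<^sup>2)"
proof -
  obtain B where B: "AE \<omega> in M. \<bar>X \<omega>\<bar> \<le> B" using assms by (auto simp: ess_bdd_def)
  note [measurable] = measurable_M[OF \<gamma>_adapted, of n] ess_bdd_measurable[OF assms]
  show ?thesis
  proof (rule Bochner_Integration.integrable_bound)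
    show "integrable M (\<lambda>\<omega>. B * (norm (\<gamma> n \<omega>))\<^sup>2)" using norm_\<gamma>_square_integrable by simp
    show "AE \<omega> in M. norm (X \<omega> * (norm (\<gamma> n \<omega>))\<^sup>2) \<le> norm (B * (norm (\<gamma> n \<omega>))\<^sup>2)"
      using B by eventually_elim (auto simp: abs_mult intro!: mult_right_mono)
  qed measurable
qed

lemma cond_exp_norm_\<gamma>_square:
  "AE \<omega> in M. real_cond_exp M (F n) (\<lambda>\<omega>. (norm (\<gamma> n \<omega>))\<^sup>2) \<omega> \<le> v n \<omega>"
  using second_moment[of n]
proof eventually_elim
  case (elim \<omega>)
  have "0 \<le> v n \<omega>" using \<sigma>0_nonneg \<sigma>1_pos by (simp add: adagrad_quantities.v_def)
  then have "enn2real (nn_cond_exp M (F n) (\<lambda>\<omega>. ennreal ((norm (\<gamma> n \<omega>))\<^sup>2)) \<omega>) \<le> v n \<omega>"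
    using elim by (intro enn2real_leI) (auto simp: adagrad_quantities.v_def)
  moreover have "real_cond_exp M (F n) (\<lambda>\<omega>. (norm (\<gamma> n \<omega>))\<^sup>2) \<omega>
      \<le> enn2real (nn_cond_exp M (F n) (\<lambda>\<omega>. ennreal ((norm (\<gamma> n \<omega>))\<^sup>2)) \<omega>)"
    unfolding real_cond_exp_def by simp
  ultimately show ?case by linarith
qed

lemma inner_integrable:
  assumes X: "X \<in> borel_measurable M" and bound: "\<And>\<omega>. \<omega> \<in> space M \<Longrightarrow> norm (X \<omega>) \<le> B"
  shows "integrable M (\<lambda>\<omega>. inner (X \<omega>) (\<gamma> n \<omega>))"
proof (rule Bochner_Integration.integrable_bound)
  note [measurable] = measurable_M[OF \<gamma>_adapted, of n] X
  show "integrable M (\<lambda>\<omega>. B\<^sup>2 + (norm (\<gamma> n \<omega>))\<^sup>2)" using norm_\<gamma>_square_integrable by simp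
  show "(\<lambda>\<omega>. inner (X \<omega>) (\<gamma> n \<omega>)) \<in> borel_measurable M" by measurable
  have "norm (inner (X \<omega>) (\<gamma> n \<omega>)) \<le> norm (B\<^sup>2 + (norm (\<gamma> n \<omega>))\<^sup>2)" if "\<omega> \<in> space M" for \<omega>
  proof -
    have "\<bar>inner (X \<omega>) (\<gamma> n \<omega>)\<bar> \<le> norm (X \<omega>) * norm (\<gamma> n \<omega>)" by (rule Cauchy_Schwarz_ineq2)
    also have "\<dots> \<le> B * norm (\<gamma> n \<omega>)" using bound[OF that] by (intro mult_right_mono) auto
    also have "\<dots> \<le> B\<^sup>2 + (norm (\<gamma> n \<omega>))\<^sup>2"
    proof -
      have "0 \<le> (B - norm (\<gamma> n \<omega>))\<^sup>2" by simp
      then have "2 * (B * norm (\<gamma> n \<omega>)) \<le> B\<^sup>2 + (norm (\<gamma> n \<omega>))\<^sup>2"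
        by (simp add: power2_eq_square algebra_simps)
      moreover have "0 \<le> B * norm (\<gamma> n \<omega>)"
        using bound[OF that] norm_ge_zero[of "X \<omega>"] by (intro mult_nonneg_nonneg norm_ge_zero) linarith
      ultimately show ?thesis by linarith
    qed
    finally show ?thesis by simp
  qed
  then show "AE \<omega> in M. norm (inner (X \<omega>) (\<gamma> n \<omega>)) \<le> norm (B\<^sup>2 + (norm (\<gamma> n \<omega>))\<^sup>2)" by simp
qed

lemma inner_grad_integrable: "integrable M (\<lambda>\<omega>. inner (grad n \<omega>) (\<gamma> n \<omega>))"
  by (rule inner_integrable[OF measurable_M[OF grad_adapted] norm_grad_le])

text \<open>
  Unbiasedness is a statement about coordinates. The coordinates of the gradient are known at time
  \<open>n\<close> and can be pulled out of the conditional expectation.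
\<close>

lemma cond_exp_inner_grad:
  "AE \<omega> in M. real_cond_exp M (F n) (\<lambda>\<omega>. inner (grad n \<omega>) (\<gamma> n \<omega>)) \<omega> = (norm (grad n \<omega>))\<^sup>2"
proof -
  interpret sigma_finite_subalgebra M "F n" by (rule sigma_finite_F)
  note [measurable] = grad_adapted[of n] measurable_M[OF \<gamma>_adapted, of n] measurable_M[OF grad_adapted, of n]
  have int: "integrable M (\<lambda>\<omega>. inner (grad n \<omega>) b * inner (\<gamma> n \<omega>) b)" if "b \<in> Basis" for b
  proof -
    have "norm (inner (grad n \<omega>) b *\<^sub>R b) \<le> grad_bound n" if "\<omega> \<in> space M" for \<omega>
      using norm_grad_le[OF that, of n] Basis_le_norm[OF \<open>b \<in> Basis\<close>, of "grad n \<omega>"] \<open>b \<in> Basis\<close> by simp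
    then have "integrable M (\<lambda>\<omega>. inner (inner (grad n \<omega>) b *\<^sub>R b) (\<gamma> n \<omega>))"
      by (intro inner_integrable) measurable
    then show ?thesis by (simp add: inner_commute)
  qed
  have "AE \<omega> in M. \<forall>b\<in>Basis. real_cond_exp M (F n) (\<lambda>\<omega>. inner (grad n \<omega>) b * inner (\<gamma> n \<omega>) b) \<omega>
      = inner (grad n \<omega>) b * inner (grad n \<omega>) b"
  proof (rule AE_finite_allI)
    fix b :: 'a assume b: "b \<in> Basis"
    have "AE \<omega> in M. real_cond_exp M (F n) (\<lambda>\<omega>. inner (grad n \<omega>) b * inner (\<gamma> n \<omega>) b) \<omega>
        = inner (grad n \<omega>) b * real_cond_exp M (F n) (\<lambda>\<omega>. inner (\<gamma> n \<omega>) b) \<omega>"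
      by (rule real_cond_exp_mult) (use int[OF b] in measurable)
    with unbiased[OF b, of n] show "AE \<omega> in M. real_cond_exp M (F n)
        (\<lambda>\<omega>. inner (grad n \<omega>) b * inner (\<gamma> n \<omega>) b) \<omega> = inner (grad n \<omega>) b * inner (grad n \<omega>) b"
      by eventually_elim simp
  qed simp
  moreover have "AE \<omega> in M. real_cond_exp M (F n)
        (\<lambda>\<omega>. \<Sum>b\<in>Basis. inner (grad n \<omega>) b * inner (\<gamma> n \<omega>) b) \<omega>
      = (\<Sum>b\<in>Basis. real_cond_exp M (F n) (\<lambda>\<omega>. inner (grad n \<omega>) b * inner (\<gamma> n \<omega>) b) \<omega>)"
  proof -
    have "integrable M (\<lambda>\<omega>. if b \<in> Basis then inner (grad n \<omega>) b * inner (\<gamma> n \<omega>) b else 0)" for b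
      using int by (cases "b \<in> Basis") auto
    then show ?thesis
      using real_cond_exp_sum[of "\<lambda>b \<omega>. if b \<in> Basis then inner (grad n \<omega>) b * inner (\<gamma> n \<omega>) b else 0" Basis]
      by simp
  qed
  ultimately show ?thesis
  proof eventually_elim
    case (elim \<omega>)
    then show ?case
      by (simp add: euclidean_inner[of "dg _" "\<gamma> _ _"] power2_norm_eq_inner euclidean_inner[of "dg _" "dg _"])
  qed
qed

lemma expectation_inner_grad:
  "expectation (\<lambda>\<omega>. inner (grad n \<omega>) (\<gamma> n \<omega>)) = expectation (\<lambda>\<omega>. (norm (grad n \<omega>))\<^sup>2)"
proof -
  interpret sigma_finite_subalgebra M "F n" by (rule sigma_finite_F)
  have "expectation (\<lambda>\<omega>. inner (grad n \<omega>) (\<gamma> n \<omega>))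
      = expectation (real_cond_exp M (F n) (\<lambda>\<omega>. inner (grad n \<omega>) (\<gamma> n \<omega>)))"
    by (rule real_cond_exp_int(2)[OF inner_grad_integrable, symmetric])
  also have "\<dots> = expectation (\<lambda>\<omega>. (norm (grad n \<omega>))\<^sup>2)"
    using cond_exp_inner_grad[of n] measurable_M[OF grad_adapted, of n]
    by (intro integral_cong_AE) auto
  finally show ?thesis .
qed

lemma expectation_norm_\<gamma>_square:
  "expectation (\<lambda>\<omega>. (norm (\<gamma> n \<omega>))\<^sup>2) \<le> \<sigma>\<^sub>0 * expectation (\<lambda>\<omega>. (norm (grad n \<omega>))\<^sup>2) + \<sigma>\<^sub>1"
proof -
  interpret sigma_finite_subalgebra M "F n" by (rule sigma_finite_F)
  have "expectation (\<lambda>\<omega>. (norm (\<gamma> n \<omega>))\<^sup>2) = expectation (real_cond_exp M (F n) (\<lambda>\<omega>. (norm (\<gamma> n \<omega>))\<^sup>2))"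
    by (rule real_cond_exp_int(2)[OF norm_\<gamma>_square_integrable, symmetric])
  also have "\<dots> \<le> expectation (v n)"
    by (rule integral_mono_AE[OF real_cond_exp_int(1)[OF norm_\<gamma>_square_integrable]
          ess_bdd_integrable[OF ess_bdd_v] cond_exp_norm_\<gamma>_square])
  also have "\<dots> = \<sigma>\<^sub>0 * expectation (\<lambda>\<omega>. (norm (grad n \<omega>))\<^sup>2) + \<sigma>\<^sub>1"
    unfolding adagrad_quantities.v_def
    using ess_bdd_integrable[OF ess_bdd_square[OF ess_bdd_norm_grad[of n]]] by (simp add: prob_space)
  finally show ?thesis .
qed

text \<open>
  The pathwise upper bound of \<open>Y\<close> has coefficients known at time \<open>n\<close>, and its two parts have
  conditional expectations \<open>- \<alpha> * \<zeta> n\<close> and at most \<open>\<alpha> / 4 * \<zeta> n\<close>.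
\<close>

lemma cond_exp_Y: "AE \<omega> in M. real_cond_exp M (F n) (Y n) \<omega> \<le> - (3 / 4 * \<alpha> * \<zeta> n \<omega>)"
proof -
  interpret sigma_finite_subalgebra M "F n" by (rule sigma_finite_F)
  define p where "p = (\<lambda>\<omega>. - \<alpha> * u n \<omega>)"
  define q where "q = (\<lambda>\<omega>. \<alpha> / 4 * (\<zeta> n \<omega> / v n \<omega>))"
  note [measurable] = u_adapted[of n] \<zeta>_adapted[of n] v_adapted[of n]
    measurable_M[OF \<gamma>_adapted, of n] measurable_M[OF grad_adapted, of n]
  have p_adapted [measurable]: "p \<in> borel_measurable (F n)" and q_adapted [measurable]: "q \<in> borel_measurable (F n)"
    unfolding p_def q_def by measurable
  have p_bdd: "ess_bdd p"
    unfolding p_def by (intro ess_bdd_mult ess_bdd_const ess_bdd_u)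
  have q_bdd: "ess_bdd q"
  proof -
    have "\<bar>1 / v n \<omega>\<bar> \<le> 1 / \<sigma>\<^sub>1" for \<omega>
      using \<sigma>0_nonneg \<sigma>1_pos by (simp add: adagrad_quantities.v_def frac_le add_nonneg_pos)
    then have "ess_bdd (\<lambda>\<omega>. 1 / v n \<omega>)"
      using ess_bdd_measurable[OF ess_bdd_v[of n]] by (intro ess_bddI[of _ "1 / \<sigma>\<^sub>1"]) auto
    then have "ess_bdd (\<lambda>\<omega>. \<alpha> / 4 * (\<zeta> n \<omega> * (1 / v n \<omega>)))"
      by (intro ess_bdd_mult ess_bdd_const ess_bdd_\<zeta>)
    then show ?thesis by (simp add: q_def)
  qed
  have p_int: "integrable M (\<lambda>\<omega>. p \<omega> * inner (grad n \<omega>) (\<gamma> n \<omega>))"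
  proof -
    have "norm (p \<omega> *\<^sub>R grad n \<omega>) \<le> \<alpha> * (1 / sqrt s\<^sub>0) * grad_bound n" if "\<omega> \<in> space M" for \<omega>
    proof -
      interpret P: adagrad_path g dg L "\<lambda>k. x k \<omega>" "\<lambda>k. \<gamma> k \<omega>" "\<lambda>k. s k \<omega>" \<alpha> \<sigma>\<^sub>0 \<sigma>\<^sub>1
        by (rule path[OF that])
      have "\<bar>p \<omega>\<bar> \<le> \<alpha> * (1 / sqrt s\<^sub>0)"
        using P.u_antimono[of 0 n] P.u_pos[of n] \<alpha>_pos mult_left_mono[of "P.u n" "P.u 0" \<alpha>]
        by (simp add: p_def P.u_def s_0[OF that] abs_mult)
      then have "\<bar>p \<omega>\<bar> * norm (grad n \<omega>) \<le> \<alpha> * (1 / sqrt s\<^sub>0) * grad_bound n"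
        using norm_grad_le[OF that, of n] \<alpha>_pos s\<^sub>0_pos by (intro mult_mono) auto
      then show ?thesis by simp
    qed
    then have "integrable M (\<lambda>\<omega>. inner (p \<omega> *\<^sub>R grad n \<omega>) (\<gamma> n \<omega>))"
      by (intro inner_integrable borel_measurable_scaleR ess_bdd_measurable[OF p_bdd]
          measurable_M[OF grad_adapted])
    then show ?thesis by simp
  qed
  have q_int: "integrable M (\<lambda>\<omega>. q \<omega> * (norm (\<gamma> n \<omega>))\<^sup>2)"
    by (rule weighted_norm_\<gamma>_square_integrable[OF q_bdd])
  have "AE \<omega> in M. real_cond_exp M (F n) (Y n) \<omega>
      \<le> real_cond_exp M (F n) (\<lambda>\<omega>. p \<omega> * inner (grad n \<omega>) (\<gamma> n \<omega>) + q \<omega> * (norm (\<gamma> n \<omega>))\<^sup>2) \<omega>"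
  proof (rule real_cond_exp_mono)
    show "AE \<omega> in M. Y n \<omega> \<le> p \<omega> * inner (grad n \<omega>) (\<gamma> n \<omega>) + q \<omega> * (norm (\<gamma> n \<omega>))\<^sup>2"
      unfolding p_def q_def using adagrad_path.Y_le[OF path] by (intro AE_I2) simp
  qed (use ess_bdd_integrable[OF ess_bdd_Y] p_int q_int in auto)
  moreover note real_cond_exp_add[OF p_int q_int]
  moreover have "AE \<omega> in M. real_cond_exp M (F n) (\<lambda>\<omega>. p \<omega> * inner (grad n \<omega>) (\<gamma> n \<omega>)) \<omega>
      = p \<omega> * real_cond_exp M (F n) (\<lambda>\<omega>. inner (grad n \<omega>) (\<gamma> n \<omega>)) \<omega>"
    by (rule real_cond_exp_mult[OF p_adapted _ p_int]) measurable
  moreover have "AE \<omega> in M. real_cond_exp M (F n) (\<lambda>\<omega>. q \<omega> * (norm (\<gamma> n \<omega>))\<^sup>2) \<omega>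
      = q \<omega> * real_cond_exp M (F n) (\<lambda>\<omega>. (norm (\<gamma> n \<omega>))\<^sup>2) \<omega>"
    by (rule real_cond_exp_mult[OF q_adapted _ q_int]) measurable
  moreover note cond_exp_inner_grad[of n]
  moreover note cond_exp_norm_\<gamma>_square[of n]
  ultimately show ?thesis using AE_space
  proof eventually_elim
    case (elim \<omega>)
    interpret P: adagrad_path g dg L "\<lambda>k. x k \<omega>" "\<lambda>k. \<gamma> k \<omega>" "\<lambda>k. s k \<omega>" \<alpha> \<sigma>\<^sub>0 \<sigma>\<^sub>1
      by (rule path) (use elim in blast)
    have "0 \<le> q \<omega>" using \<alpha>_pos P.\<zeta>_nonneg[of n] P.v_pos[of n] by (simp add: q_def)
    then have "q \<omega> * real_cond_exp M (F n) (\<lambda>\<omega>. (norm (\<gamma> n \<omega>))\<^sup>2) \<omega> \<le> q \<omega> * P.v n"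
      using elim by (intro mult_left_mono) auto
    also have "\<dots> = \<alpha> / 4 * P.\<zeta> n" using P.v_pos[of n] by (simp add: q_def)
    moreover have "p \<omega> * (norm (grad n \<omega>))\<^sup>2 = - \<alpha> * P.\<zeta> n" by (simp add: p_def P.\<zeta>_def)
    ultimately show ?case using elim by (simp add: algebra_simps)
  qed
qed

end

section \<open>The second moment of the objective along the path\<close>

text \<open>
  The weight \<open>\<epsilon>\<close> is at disposal in \<open>sum_Y_squares\<close>, but \<open>r \<epsilon>\<close> blows up as \<open>\<epsilon>\<close> tends to 0. This is
  harmless as \<open>r \<epsilon>\<close> only multiplies \<open>R * K\<close>, which Young's inequality splits with any weight.
\<close>

lemma young_absorb:
  fixes a b c p q \<delta> :: real and r :: "real \<Rightarrow> real"
  assumes "0 \<le> b" "0 \<le> c" "0 \<le> q" "0 < \<delta>"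
  obtains \<epsilon> C where "0 < \<epsilon>" "0 \<le> C"
    "\<And>R K. 0 \<le> R \<Longrightarrow> 0 \<le> K \<Longrightarrow>
      a * R * K + b * R * (p + \<epsilon> * (q * R) + r \<epsilon> * K) + c \<le> \<delta> * R\<^sup>2 + C * (1 + K\<^sup>2)"
proof -
  define \<epsilon> where "\<epsilon> = \<delta> / (2 * (b * q) + 2)"
  have "0 < \<delta> / (2 * m + 2)" "m * (\<delta> / (2 * m + 2)) \<le> \<delta> / 2" if "0 \<le> m" for m
    using that assms(4) by (auto simp: field_simps)
  from this[of "b * q"] have \<epsilon>: "0 < \<epsilon>" "b * q * \<epsilon> \<le> \<delta> / 2"
    using assms by (auto simp: \<epsilon>_def)
  define A where "A = b * p"
  define B where "B = a + b * r \<epsilon>"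
  define C where "C = (A\<^sup>2 + B\<^sup>2) / \<delta> + c"
  have "a * R * K + b * R * (p + \<epsilon> * (q * R) + r \<epsilon> * K) + c \<le> \<delta> * R\<^sup>2 + C * (1 + K\<^sup>2)"
    if "0 \<le> R" "0 \<le> K" for R K
  proof -
    have "a * R * K + b * R * (p + \<epsilon> * (q * R) + r \<epsilon> * K) + c = b * q * \<epsilon> * R\<^sup>2 + R * (A + B * K) + c"
      by (simp add: A_def B_def power2_eq_square algebra_simps)
    moreover have "b * q * \<epsilon> * R\<^sup>2 \<le> \<delta> / 2 * R\<^sup>2"
      by (rule mult_right_mono[OF \<epsilon>(2)]) simp
    moreover have "R * (A + B * K) \<le> \<delta> / 2 * R\<^sup>2 + (A + B * K)\<^sup>2 / (2 * \<delta>)"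
    proof -
      have "0 \<le> (\<delta> * R - (A + B * K))\<^sup>2 / (2 * \<delta>)" using assms(4) by simp
      also have "\<dots> = \<delta> / 2 * R\<^sup>2 + (A + B * K)\<^sup>2 / (2 * \<delta>) - R * (A + B * K)"
        using assms(4) by (simp add: power2_eq_square field_simps)
      finally show ?thesis by simp
    qed
    moreover have "(A + B * K)\<^sup>2 / (2 * \<delta>) \<le> (A\<^sup>2 + B\<^sup>2) / \<delta> * (1 + K\<^sup>2)"
    proof -
      have "0 \<le> (A - B * K)\<^sup>2 + 2 * (A * K)\<^sup>2 + 2 * B\<^sup>2" by simp
      then have "(A + B * K)\<^sup>2 \<le> 2 * (A\<^sup>2 + B\<^sup>2) * (1 + K\<^sup>2)"
        by (simp add: power2_eq_square algebra_simps)
      then have "(A + B * K)\<^sup>2 / (2 * \<delta>) \<le> 2 * (A\<^sup>2 + B\<^sup>2) * (1 + K\<^sup>2) / (2 * \<delta>)"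
        using assms(4) by (intro divide_right_mono) auto
      also have "\<dots> = (A\<^sup>2 + B\<^sup>2) / \<delta> * (1 + K\<^sup>2)"
        using assms(4) by (simp add: field_simps)
      finally show ?thesis .
    qed
    moreover have "c \<le> c * (1 + K\<^sup>2)" using assms(2) by (simp add: algebra_simps)
    ultimately show ?thesis unfolding C_def by (simp only: distrib_right)
  qed
  moreover have "0 \<le> C" using assms by (simp add: C_def)
  ultimately show ?thesis using that \<epsilon>(1) by blast
qed

context adagrad_process
begin

text \<open>The martingale part of \<open>Y\<close>.\<close>

definition d :: "nat \<Rightarrow> 'w \<Rightarrow> real" where "d n \<omega> = Y n \<omega> - real_cond_exp M (F n) (Y n) \<omega>"

lemma ess_bdd_cond_exp_Y: "ess_bdd (real_cond_exp M (F n) (Y n))"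
proof -
  interpret sigma_finite_subalgebra M "F n" by (rule sigma_finite_F)
  obtain B where B: "AE \<omega> in M. \<bar>Y n \<omega>\<bar> \<le> B" using ess_bdd_Y[of n] by (auto simp: ess_bdd_def)
  note int = ess_bdd_integrable[OF ess_bdd_Y[of n]]
  have "AE \<omega> in M. Y n \<omega> \<le> B" "AE \<omega> in M. - B \<le> Y n \<omega>"
    using B by (eventually_elim, linarith)+
  from real_cond_exp_le_c[OF int this(1)] real_cond_exp_ge_c[OF int this(2)]
  have "AE \<omega> in M. \<bar>real_cond_exp M (F n) (Y n) \<omega>\<bar> \<le> B" by eventually_elim linarith
  then show ?thesis by (intro ess_bddI) auto
qed

sublocale bounded_martingale M F d
proof
  fix n
  show "subalgebra (F (Suc n)) (F n)" by (rule subalg_Suc)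
  have "real_cond_exp M (F n) (Y n) \<in> borel_measurable (F (Suc n))"
    by (rule measurable_from_subalg[OF subalg_Suc]) simp
  then show "d n \<in> borel_measurable (F (Suc n))"
    unfolding d_def[abs_def] using Y_adapted[of n] by simp
  show "ess_bdd (d n)"
    unfolding d_def[abs_def] by (intro ess_bdd_diff ess_bdd_Y ess_bdd_cond_exp_Y)
  fix X assume X: "X \<in> borel_measurable (F n)" "ess_bdd X"
  interpret sigma_finite_subalgebra M "F n" by (rule sigma_finite_F)
  note int = ess_bdd_integrable[OF ess_bdd_mult[OF X(2) ess_bdd_Y[of n]]]
  have "expectation (\<lambda>\<omega>. X \<omega> * d n \<omega>)
      = expectation (\<lambda>\<omega>. X \<omega> * Y n \<omega>) - expectation (\<lambda>\<omega>. X \<omega> * real_cond_exp M (F n) (Y n) \<omega>)"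
    using int ess_bdd_integrable[OF ess_bdd_mult[OF X(2) ess_bdd_cond_exp_Y[of n]]]
    by (simp add: d_def right_diff_distrib)
  also have "\<dots> = 0"
    using real_cond_exp_intg(2)[OF int X(1) ess_bdd_measurable[OF ess_bdd_Y[of n]]] by simp
  finally show "expectation (\<lambda>\<omega>. X \<omega> * d n \<omega>) = 0" .
qed

text \<open>Centring is an orthogonal projection.\<close>

lemma expectation_d_square: "expectation (\<lambda>\<omega>. (d n \<omega>)\<^sup>2) \<le> expectation (\<lambda>\<omega>. (Y n \<omega>)\<^sup>2)"
proof -
  let ?C = "real_cond_exp M (F n) (Y n)"
  have bdd: "ess_bdd (\<lambda>\<omega>. (d n \<omega>)\<^sup>2)" "ess_bdd (\<lambda>\<omega>. (?C \<omega>)\<^sup>2)" "ess_bdd (\<lambda>\<omega>. ?C \<omega> * d n \<omega>)"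
    by (intro ess_bdd_square ess_bdd_mult increment_bounded ess_bdd_cond_exp_Y)+
  have "expectation (\<lambda>\<omega>. (Y n \<omega>)\<^sup>2)
      = expectation (\<lambda>\<omega>. (d n \<omega>)\<^sup>2 + (?C \<omega>)\<^sup>2 + 2 * (?C \<omega> * d n \<omega>))"
    by (intro Bochner_Integration.integral_cong refl) (simp add: d_def power2_eq_square algebra_simps)
  also have "\<dots> = expectation (\<lambda>\<omega>. (d n \<omega>)\<^sup>2) + expectation (\<lambda>\<omega>. (?C \<omega>)\<^sup>2)
      + 2 * expectation (\<lambda>\<omega>. ?C \<omega> * d n \<omega>)"
    using bdd[THEN ess_bdd_integrable] by simp
  also have "expectation (\<lambda>\<omega>. ?C \<omega> * d n \<omega>) = 0"
    by (rule increment_orthogonal[OF _ ess_bdd_cond_exp_Y]) simp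
  finally show ?thesis by simp
qed

definition K :: "nat \<Rightarrow> 'w \<Rightarrow> real" where "K n \<omega> = (\<Sum>k<n. \<Gamma> k \<omega>)"

text \<open>The value of \<open>drift_const\<close>, which is the same for all trajectories.\<close>

definition C\<^sub>0 :: real
  where "C\<^sub>0 = g x\<^sub>0 * (1 + 2 * \<alpha> * L * \<sigma>\<^sub>0 * (1 / sqrt s\<^sub>0)) + \<alpha> * \<sigma>\<^sub>1 * (1 / sqrt s\<^sub>0)
    + (2 * \<alpha> * L * \<sigma>\<^sub>0 * (1 / sqrt s\<^sub>0 * \<alpha>\<^sup>2 * (2 * L * \<sigma>\<^sub>0 + 2 + L / 2)) + L * \<alpha>\<^sup>2 / 2)"

text \<open>
  A bound for both \<open>g\<close> along the path up to time \<open>n\<close> and, up to a constant factor, the sum of \<open>\<zeta>\<close>.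
\<close>

definition R :: "nat \<Rightarrow> 'w \<Rightarrow> real" where "R n \<omega> = W_max n \<omega> + C\<^sub>0 * (1 + K n \<omega>)"

lemma u_0:
  assumes "\<omega> \<in> space M"
  shows "u 0 \<omega> = 1 / sqrt s\<^sub>0"
  by (simp add: adagrad_quantities.u_def s_0[OF assms])

lemma drift_const_eq:
  assumes "\<omega> \<in> space M"
  shows "adagrad_path.drift_const g L (\<lambda>k. x k \<omega>) (\<lambda>k. s k \<omega>) \<alpha> \<sigma>\<^sub>0 \<sigma>\<^sub>1 = C\<^sub>0"
  unfolding adagrad_path.drift_const_def[OF path[OF assms]] C\<^sub>0_def
  by (simp add: u_0[OF assms] x_0[OF assms])

lemma C\<^sub>0_nonneg: "0 \<le> C\<^sub>0"
  using nonneg[of x\<^sub>0] \<alpha>_pos L_pos \<sigma>0_nonneg \<sigma>1_pos s\<^sub>0_pos by (simp add: C\<^sub>0_def)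

lemma K_bounds:
  assumes "\<omega> \<in> space M"
  shows "0 \<le> K n \<omega>" "K n \<omega> \<le> ln (s n \<omega> / s\<^sub>0)" "m \<le> n \<Longrightarrow> K m \<omega> \<le> K n \<omega>"
proof -
  interpret P: adagrad_path g dg L "\<lambda>k. x k \<omega>" "\<lambda>k. \<gamma> k \<omega>" "\<lambda>k. s k \<omega>" \<alpha> \<sigma>\<^sub>0 \<sigma>\<^sub>1
    by (rule path[OF assms])
  show "0 \<le> K n \<omega>" unfolding K_def by (intro sum_nonneg P.\<Gamma>_nonneg)
  show "K n \<omega> \<le> ln (s n \<omega> / s\<^sub>0)" using P.sum_\<Gamma>[of n] by (simp add: K_def s_0[OF assms])
  show "K m \<omega> \<le> K n \<omega>" if "m \<le> n"
    unfolding K_def by (intro sum_mono2) (use that P.\<Gamma>_nonneg in auto)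
qed

lemma ess_bdd_K: "ess_bdd (K n)"
  unfolding K_def[abs_def] by (intro ess_bdd_sum ess_bdd_\<Gamma>)

lemma ess_bdd_R: "ess_bdd (R n)"
  unfolding R_def[abs_def] by (intro ess_bdd_add ess_bdd_mult ess_bdd_const ess_bdd_K ess_bdd_W_max)

lemma R_nonneg: "\<omega> \<in> space M \<Longrightarrow> 0 \<le> R n \<omega>"
  using W_max_nonneg[of n \<omega>] C\<^sub>0_nonneg K_bounds(1)[of \<omega> n] by (simp add: R_def)

lemma R_bounds:
  "AE \<omega> in M. (\<forall>k\<le>n. g (x k \<omega>) \<le> R n \<omega>) \<and> (\<Sum>k<n. \<zeta> k \<omega>) \<le> 2 / \<alpha> * R n \<omega>"
proof -
  have "AE \<omega> in M. \<forall>k. real_cond_exp M (F k) (Y k) \<omega> \<le> - (3 / 4 * \<alpha> * \<zeta> k \<omega>)"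
    unfolding AE_all_countable using cond_exp_Y by blast
  then show ?thesis using AE_space
  proof eventually_elim
    case (elim \<omega>)
    interpret P: adagrad_path g dg L "\<lambda>k. x k \<omega>" "\<lambda>k. \<gamma> k \<omega>" "\<lambda>k. s k \<omega>" \<alpha> \<sigma>\<^sub>0 \<sigma>\<^sub>1
      by (rule path) (use elim in blast)
    have *: "g (x k \<omega>) + \<alpha> / 2 * (\<Sum>j<k. P.\<zeta> j) \<le> R n \<omega>" if "k \<le> n" for k
    proof -
      have "P.Y j \<le> d j \<omega> - 3 / 4 * \<alpha> * P.\<zeta> j" for j
      proof -
        have "real_cond_exp M (F j) (Y j) \<omega> \<le> - (3 / 4 * \<alpha> * P.\<zeta> j)" using elim by blast
        then show ?thesis by (simp add: d_def)
      qed
      then have "g (x k \<omega>) + \<alpha> / 2 * (\<Sum>j<k. P.\<zeta> j) \<le> (\<Sum>j<k. d j \<omega>) + P.drift_const * (1 + (\<Sum>j<k. P.\<Gamma> j))"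
        by (rule P.drift_bound)
      also have "\<dots> = W k \<omega> + C\<^sub>0 * (1 + K k \<omega>)"
        using elim by (simp add: W_def K_def drift_const_eq)
      also have "\<dots> \<le> R n \<omega>"
        unfolding R_def using C\<^sub>0_nonneg W_le_W_max[OF that] K_bounds(3)[OF _ that] elim
        by (intro add_mono mult_left_mono) auto
      finally show ?thesis .
    qed
    have zeta: "0 \<le> \<alpha> / 2 * (\<Sum>j<k. P.\<zeta> j)" for k
      using \<alpha>_pos by (intro mult_nonneg_nonneg sum_nonneg P.\<zeta>_nonneg) auto
    have "g (x k \<omega>) \<le> R n \<omega>" if "k \<le> n" for k
      using *[OF that] zeta[of k] by linarith
    moreover have "(\<Sum>k<n. P.\<zeta> k) \<le> 2 / \<alpha> * R n \<omega>"
      using *[of n] nonneg[of "x n \<omega>"] \<alpha>_pos by (simp add: field_simps)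
    ultimately show ?case by blast
  qed
qed

lemma sum_Y_squares_le:
  assumes "0 < \<delta>"
  obtains C where "0 \<le> C" "\<And>n. AE \<omega> in M. (\<Sum>k<n. (Y k \<omega>)\<^sup>2) \<le> \<delta> * (R n \<omega>)\<^sup>2 + C * (1 + (K n \<omega>)\<^sup>2)"
proof -
  let ?u = "1 / sqrt s\<^sub>0"
  obtain \<epsilon> C where \<epsilon>: "0 < \<epsilon>" and C: "0 \<le> C" and bound: "\<And>R K. 0 \<le> R \<Longrightarrow> 0 \<le> K \<Longrightarrow>
      (4 * \<alpha>\<^sup>2 * L) * R * K + (16 * \<alpha>\<^sup>2 * L\<^sup>2 * \<sigma>\<^sub>0\<^sup>2 * ?u) * R * (g x\<^sub>0 * ?u + \<epsilon> * (2 / \<alpha> * R)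
        + (?u * \<alpha>\<^sup>2 * (1 / (4 * \<epsilon>) + L / 2)) * K) + 4 * \<alpha>\<^sup>2 * \<sigma>\<^sub>1\<^sup>2 * ?u\<^sup>2 \<le> \<delta> * R\<^sup>2 + C * (1 + K\<^sup>2)"
  proof (rule young_absorb[where a = "4 * \<alpha>\<^sup>2 * L" and b = "16 * \<alpha>\<^sup>2 * L\<^sup>2 * \<sigma>\<^sub>0\<^sup>2 * ?u" and p = "g x\<^sub>0 * ?u"
        and q = "2 / \<alpha>" and c = "4 * \<alpha>\<^sup>2 * \<sigma>\<^sub>1\<^sup>2 * ?u\<^sup>2" and \<delta> = \<delta>
        and r = "\<lambda>\<epsilon>. ?u * \<alpha>\<^sup>2 * (1 / (4 * \<epsilon>) + L / 2)"])
    show "0 \<le> 16 * \<alpha>\<^sup>2 * L\<^sup>2 * \<sigma>\<^sub>0\<^sup>2 * ?u" "0 \<le> 4 * \<alpha>\<^sup>2 * \<sigma>\<^sub>1\<^sup>2 * ?u\<^sup>2" "0 \<le> 2 / \<alpha>" "0 < \<delta>"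
      using assms s\<^sub>0_pos \<alpha>_pos by auto
  qed blast
  have "AE \<omega> in M. (\<Sum>k<n. (Y k \<omega>)\<^sup>2) \<le> \<delta> * (R n \<omega>)\<^sup>2 + C * (1 + (K n \<omega>)\<^sup>2)" for n
    using R_bounds[of n] AE_space
  proof eventually_elim
    case (elim \<omega>)
    then have \<omega>: "\<omega> \<in> space M" by blast
    interpret P: adagrad_path g dg L "\<lambda>k. x k \<omega>" "\<lambda>k. \<gamma> k \<omega>" "\<lambda>k. s k \<omega>" \<alpha> \<sigma>\<^sub>0 \<sigma>\<^sub>1
      by (rule path[OF \<omega>])
    note P.sum_Y_squares[of n "R n \<omega>" \<epsilon>, folded K_def, unfolded u_0[OF \<omega>] x_0[OF \<omega>]]
    then have "(\<Sum>k<n. (P.Y k)\<^sup>2) \<le> (4 * \<alpha>\<^sup>2 * L) * R n \<omega> * K n \<omega>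
        + (16 * \<alpha>\<^sup>2 * L\<^sup>2 * \<sigma>\<^sub>0\<^sup>2 * ?u) * R n \<omega> * (g x\<^sub>0 * ?u + \<epsilon> * (2 / \<alpha> * R n \<omega>)
        + (?u * \<alpha>\<^sup>2 * (1 / (4 * \<epsilon>) + L / 2)) * K n \<omega>) + 4 * \<alpha>\<^sup>2 * \<sigma>\<^sub>1\<^sup>2 * ?u\<^sup>2"
      using elim \<epsilon> R_nonneg[OF \<omega>] by simp
    also have "\<dots> \<le> \<delta> * (R n \<omega>)\<^sup>2 + C * (1 + (K n \<omega>)\<^sup>2)"
      by (rule bound[OF R_nonneg[OF \<omega>] K_bounds(1)[OF \<omega>]])
    finally show ?case .
  qed
  with C show ?thesis by (rule that)
qed

text \<open>
  The second moment of \<open>R\<close> bounds the quadratic variation of the martingale, which by Doob's inequality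
  bounds the second moment of \<open>R\<close>. The factor in the first bound is at disposal, and the second
  moment is finite, so that it can be absorbed.
\<close>

lemma expectation_R_square:
  obtains C where "0 \<le> C" "\<And>n. expectation (\<lambda>\<omega>. (R n \<omega>)\<^sup>2) \<le> C * (1 + expectation (\<lambda>\<omega>. (K n \<omega>)\<^sup>2))"
proof -
  \<comment> \<open>Splitting the square of \<open>R\<close> and Doob's inequality cost a factor \<open>2 * 4\<close>; then \<open>1 / 2\<close> is left to absorb.\<close>
  obtain C where C: "0 \<le> C"
    and sum_Y: "\<And>n. AE \<omega> in M. (\<Sum>k<n. (Y k \<omega>)\<^sup>2) \<le> 1 / 16 * (R n \<omega>)\<^sup>2 + C * (1 + (K n \<omega>)\<^sup>2)"
    by (rule sum_Y_squares_le[of "1 / 16"]) auto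
  have "expectation (\<lambda>\<omega>. (R n \<omega>)\<^sup>2) \<le> (16 * C + 8 * C\<^sub>0\<^sup>2) * (1 + expectation (\<lambda>\<omega>. (K n \<omega>)\<^sup>2))" for n
  proof -
    let ?r = "expectation (\<lambda>\<omega>. (R n \<omega>)\<^sup>2)" and ?k = "expectation (\<lambda>\<omega>. (K n \<omega>)\<^sup>2)"
    note int = ess_bdd_integrable[OF ess_bdd_square[OF ess_bdd_R[of n]]]
      ess_bdd_integrable[OF ess_bdd_square[OF ess_bdd_K[of n]]]
      ess_bdd_integrable[OF ess_bdd_square[OF ess_bdd_W_max[of n]]]
      ess_bdd_integrable[OF ess_bdd_square[OF ess_bdd_Y]]
    have "(\<Sum>k<n. expectation (\<lambda>\<omega>. (d k \<omega>)\<^sup>2)) \<le> (\<Sum>k<n. expectation (\<lambda>\<omega>. (Y k \<omega>)\<^sup>2))"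
      by (intro sum_mono expectation_d_square)
    also have "\<dots> = expectation (\<lambda>\<omega>. \<Sum>k<n. (Y k \<omega>)\<^sup>2)"
      using int by simp
    also have "\<dots> \<le> expectation (\<lambda>\<omega>. 1 / 16 * (R n \<omega>)\<^sup>2 + C * (1 + (K n \<omega>)\<^sup>2))"
      using sum_Y[of n] int by (intro integral_mono_AE) auto
    also have "\<dots> = 1 / 16 * ?r + C * (1 + ?k)"
      using int by (simp add: prob_space)
    finally have sum_d: "(\<Sum>k<n. expectation (\<lambda>\<omega>. (d k \<omega>)\<^sup>2)) \<le> 1 / 16 * ?r + C * (1 + ?k)" .
    have "?r \<le> expectation (\<lambda>\<omega>. 2 * (W_max n \<omega>)\<^sup>2 + 4 * C\<^sub>0\<^sup>2 * (1 + (K n \<omega>)\<^sup>2))"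
    proof (rule integral_mono)
      fix \<omega>
      have "0 \<le> (W_max n \<omega> - C\<^sub>0 * (1 + K n \<omega>))\<^sup>2 + 2 * (C\<^sub>0 * (1 - K n \<omega>))\<^sup>2" by simp
      then show "(R n \<omega>)\<^sup>2 \<le> 2 * (W_max n \<omega>)\<^sup>2 + 4 * C\<^sub>0\<^sup>2 * (1 + (K n \<omega>)\<^sup>2)"
        by (simp add: R_def power2_eq_square algebra_simps)
    qed (use int in auto)
    also have "\<dots> = 2 * expectation (\<lambda>\<omega>. (W_max n \<omega>)\<^sup>2) + 4 * C\<^sub>0\<^sup>2 * (1 + ?k)"
      using int by (simp add: prob_space)
    also have "\<dots> \<le> 2 * (4 * (1 / 16 * ?r + C * (1 + ?k))) + 4 * C\<^sub>0\<^sup>2 * (1 + ?k)"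
      using expectation_W_max_square[of n] sum_d by simp
    finally show ?thesis by (simp add: algebra_simps)
  qed
  then show ?thesis using C that[of "16 * C + 8 * C\<^sub>0\<^sup>2"] by simp
qed

end

section \<open>The rate\<close>

text \<open>
  With \<open>P\<close> of the order of the expectation of \<open>y\<close>, this moves the expectation inside the squared
  logarithm up to constants, although the latter is not concave near 1.
\<close>

lemma ln_square_le:
  fixes y P :: real
  assumes "1 \<le> y" "1 \<le> P"
  shows "(ln y)\<^sup>2 \<le> 2 * (ln P)\<^sup>2 + 8 * (y / P)"
proof (cases "y \<le> P")
  case True
  then have "(ln y)\<^sup>2 \<le> (ln P)\<^sup>2"
    using assms by (intro power_mono) auto
  moreover have "0 \<le> (ln P)\<^sup>2 + 8 * (y / P)" using assms by simp
  ultimately show ?thesis by linarith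
next
  case False
  define z where "z = y / P"
  have z: "1 \<le> z" using False assms by (simp add: z_def)
  have "ln z = 2 * ln (sqrt z)" using z by (simp add: ln_sqrt)
  also have "\<dots> \<le> 2 * sqrt z" using ln_le_minus_one[of "sqrt z"] z by simp
  finally have "(ln z)\<^sup>2 \<le> (2 * sqrt z)\<^sup>2" using z by (intro power_mono) auto
  then have lnz: "(ln z)\<^sup>2 \<le> 4 * z" using z by (simp add: power_mult_distrib)
  have "ln y = ln P + ln z" using assms z by (simp add: z_def ln_div)
  then have "(ln y)\<^sup>2 = (ln P + ln z)\<^sup>2" by simp
  also have "\<dots> \<le> 2 * (ln P)\<^sup>2 + 2 * (ln z)\<^sup>2"
    using zero_le_power2[of "ln P - ln z"] by (simp add: power2_eq_square algebra_simps)
  finally show ?thesis using lnz by (simp add: z_def)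
qed

lemma one_le_ln: "1 \<le> ln (real n)" if "3 \<le> n"
proof -
  have "exp 1 \<le> (3 :: real)" by (rule exp_le)
  also have "\<dots> \<le> real n" using that by simp
  finally show ?thesis using that by (subst ln_ge_iff) auto
qed

text \<open>
  The bound of the sum \<open>X\<close> of gradients by the accumulator, whose expectation in turn contains \<open>X\<close>,
  is resolved by weighting Young's inequality with \<open>r / l + \<sigma>\<^sub>0 / \<alpha>\<close>: the first summand balances
  the two sides, the second one absorbs \<open>X\<close>. Here \<open>r\<close> and \<open>l\<close> stand for the square root and the
  logarithm of the number of steps.
\<close>

lemma self_bounding_rate:
  fixes X \<alpha> \<sigma>\<^sub>0 \<sigma>\<^sub>1 s\<^sub>0 A B l r :: real
  assumes l: "1 \<le> l" and r: "1 \<le> r" and lr: "l \<le> 2 * r"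
    and "0 < \<alpha>" "0 \<le> \<sigma>\<^sub>0" "0 \<le> \<sigma>\<^sub>1" "0 \<le> s\<^sub>0" "0 \<le> X" "0 \<le> A" "0 \<le> B"
    and bound: "\<And>\<mu>. 0 < \<mu> \<Longrightarrow>
      \<alpha> * X \<le> A + \<mu> * (B * l\<^sup>2) + (s\<^sub>0 + \<sigma>\<^sub>0 * X + \<sigma>\<^sub>1 * r\<^sup>2) / (2 * \<mu>)"
  shows "X \<le> 2 / \<alpha> * (A + B + 2 * (\<sigma>\<^sub>0 / \<alpha> * B) + (s\<^sub>0 + \<sigma>\<^sub>1) / 2) * (r * l)"
proof -
  define \<mu> where "\<mu> = r / l + \<sigma>\<^sub>0 / \<alpha>"
  have pos: "0 < r / l" "0 \<le> \<sigma>\<^sub>0 / \<alpha>" using l r assms by auto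
  then have \<mu>: "0 < \<mu>" "r / l \<le> \<mu>" "\<sigma>\<^sub>0 / \<alpha> \<le> \<mu>"
    unfolding \<mu>_def by linarith+
  have rl: "1 \<le> r * l" using mult_mono[OF r l] r by simp
  have "\<alpha> * X \<le> A + \<mu> * (B * l\<^sup>2) + (s\<^sub>0 + \<sigma>\<^sub>0 * X + \<sigma>\<^sub>1 * r\<^sup>2) / (2 * \<mu>)"
    by (rule bound[OF \<mu>(1)])
  moreover have "(s\<^sub>0 + \<sigma>\<^sub>0 * X + \<sigma>\<^sub>1 * r\<^sup>2) / (2 * \<mu>)
      = (\<sigma>\<^sub>0 * X / \<mu>) / 2 + ((s\<^sub>0 + \<sigma>\<^sub>1 * r\<^sup>2) / \<mu>) / 2"
    by (simp add: add_divide_distrib mult.commute[of 2])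
  moreover have "\<mu> * (B * l\<^sup>2) \<le> (B + 2 * (\<sigma>\<^sub>0 / \<alpha> * B)) * (r * l)"
  proof -
    have "\<mu> * (B * l\<^sup>2) = B * (r / l * l) * l + (\<sigma>\<^sub>0 / \<alpha> * B) * (l * l)"
      unfolding \<mu>_def by (simp only: power2_eq_square distrib_right distrib_left mult_ac)
    also have "r / l * l = r" using l by simp
    also have "(\<sigma>\<^sub>0 / \<alpha> * B) * (l * l) \<le> (\<sigma>\<^sub>0 / \<alpha> * B) * ((2 * r) * l)"
      using lr l pos(2) assms(10) by (intro mult_left_mono mult_right_mono mult_nonneg_nonneg) auto
    finally show ?thesis by (simp add: algebra_simps)
  qed
  moreover have "\<sigma>\<^sub>0 * X / \<mu> \<le> \<alpha> * X"
  proof -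
    have "\<sigma>\<^sub>0 \<le> \<mu> * \<alpha>" using \<mu>(3) assms(4) by (simp only: pos_divide_le_eq)
    then have "\<sigma>\<^sub>0 * X \<le> \<mu> * \<alpha> * X" using assms(8) by (rule mult_right_mono)
    then show ?thesis using \<mu>(1) by (simp add: pos_divide_le_eq mult_ac)
  qed
  moreover have "(s\<^sub>0 + \<sigma>\<^sub>1 * r\<^sup>2) / \<mu> \<le> (s\<^sub>0 + \<sigma>\<^sub>1) * (r * l)"
  proof -
    have "s\<^sub>0 * 1 \<le> s\<^sub>0 * r\<^sup>2" using assms(7) r by (intro mult_left_mono one_le_power) auto
    then have "(s\<^sub>0 + \<sigma>\<^sub>1 * r\<^sup>2) / \<mu> \<le> ((s\<^sub>0 + \<sigma>\<^sub>1) * r\<^sup>2) / (r / l)"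
      using pos(1) \<mu>(2) assms(6,7) by (intro frac_le) (auto simp: distrib_right)
    also have "\<dots> = (s\<^sub>0 + \<sigma>\<^sub>1) * (r * l)"
      using r by (simp add: power2_eq_square)
    finally show ?thesis .
  qed
  moreover have "A \<le> A * (r * l)" using mult_left_mono[OF rl assms(9)] by simp
  ultimately have "\<alpha> / 2 * X \<le> A * (r * l) + (B + 2 * (\<sigma>\<^sub>0 / \<alpha> * B)) * (r * l) + (s\<^sub>0 + \<sigma>\<^sub>1) * (r * l) / 2"
    by simp
  also have "\<dots> = (A + B + 2 * (\<sigma>\<^sub>0 / \<alpha> * B) + (s\<^sub>0 + \<sigma>\<^sub>1) / 2) * (r * l)"
    by (simp only: distrib_right add_divide_distrib times_divide_eq_left)
  finally have "2 / \<alpha> * (\<alpha> / 2 * X) \<le> 2 / \<alpha> * ((A + B + 2 * (\<sigma>\<^sub>0 / \<alpha> * B) + (s\<^sub>0 + \<sigma>\<^sub>1) / 2) * (r * l))"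
    using assms(4) by (intro mult_left_mono) auto
  moreover have "2 / \<alpha> * (\<alpha> / 2 * X) = X" using assms(4) by simp
  ultimately show ?thesis by (simp only: mult.assoc)
qed

context adagrad_process
begin

lemma norm_grad_square_integrable: "integrable M (\<lambda>\<omega>. (norm (grad n \<omega>))\<^sup>2)"
  by (rule ess_bdd_integrable[OF ess_bdd_square[OF ess_bdd_norm_grad]])

lemma s_eq:
  assumes "\<omega> \<in> space M"
  shows "s n \<omega> = s\<^sub>0 + (\<Sum>k<n. (norm (\<gamma> k \<omega>))\<^sup>2)"
  by (induction n) (simp_all add: s_0[OF assms] s_Suc[OF assms])

lemma s_integrable: "integrable M (s n)"
proof -
  have "integrable M (\<lambda>\<omega>. s\<^sub>0 + (\<Sum>k<n. (norm (\<gamma> k \<omega>))\<^sup>2))"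
    using norm_\<gamma>_square_integrable by simp
  then show ?thesis by (simp cong: Bochner_Integration.integrable_cong add: s_eq)
qed

lemma expectation_s:
  "expectation (s n) \<le> s\<^sub>0 + \<sigma>\<^sub>0 * (\<Sum>k<n. expectation (\<lambda>\<omega>. (norm (grad k \<omega>))\<^sup>2)) + \<sigma>\<^sub>1 * real n"
proof -
  have "expectation (s n) = expectation (\<lambda>\<omega>. s\<^sub>0 + (\<Sum>k<n. (norm (\<gamma> k \<omega>))\<^sup>2))"
    by (rule Bochner_Integration.integral_cong) (simp_all add: s_eq)
  also have "\<dots> = s\<^sub>0 + (\<Sum>k<n. expectation (\<lambda>\<omega>. (norm (\<gamma> k \<omega>))\<^sup>2))"
    using norm_\<gamma>_square_integrable by (simp add: prob_space)
  also have "(\<Sum>k<n. expectation (\<lambda>\<omega>. (norm (\<gamma> k \<omega>))\<^sup>2))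
      \<le> (\<Sum>k<n. \<sigma>\<^sub>0 * expectation (\<lambda>\<omega>. (norm (grad k \<omega>))\<^sup>2) + \<sigma>\<^sub>1)"
    by (intro sum_mono expectation_norm_\<gamma>_square)
  finally show ?thesis by (simp add: sum.distrib sum_distrib_left mult.commute)
qed

text \<open>
  The crude linear bound on the gradients makes the expectation of \<open>s n\<close> at most cubic in \<open>n\<close>, which
  is all that its logarithm sees.
\<close>

lemma expectation_K_square:
  obtains C where "0 \<le> C" "\<And>n. 3 \<le> n \<Longrightarrow> 1 + expectation (\<lambda>\<omega>. (K n \<omega>)\<^sup>2) \<le> C * (ln n)\<^sup>2"
proof -
  define A where "A = 1 + (\<sigma>\<^sub>0 * (norm (dg x\<^sub>0) + L * \<alpha>)\<^sup>2 + \<sigma>\<^sub>1) / s\<^sub>0"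
  have A: "1 \<le> A" using \<sigma>0_nonneg \<sigma>1_pos s\<^sub>0_pos by (simp add: A_def)
  define C where "C = 2 * (ln A + 3)\<^sup>2 + 9"
  have "1 + expectation (\<lambda>\<omega>. (K n \<omega>)\<^sup>2) \<le> C * (ln n)\<^sup>2" if n: "3 \<le> n" for n
  proof -
    have l: "1 \<le> ln (real n)" by (rule one_le_ln[OF n])
    define P where "P = A * real n ^ 3"
    have n1: "1 \<le> real n" using n by simp
    have P1: "1 \<le> P" using mult_mono[OF A one_le_power[OF n1, of 3]] A by (simp add: P_def)
    have grad_le: "expectation (\<lambda>\<omega>. (norm (grad k \<omega>))\<^sup>2) \<le> (norm (dg x\<^sub>0) + L * \<alpha>)\<^sup>2 * (real n)\<^sup>2" if "k < n" for k
    proof -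
      have "norm (grad k \<omega>) \<le> (norm (dg x\<^sub>0) + L * \<alpha>) * real n" if "\<omega> \<in> space M" for \<omega>
      proof -
        have "norm (grad k \<omega>) \<le> norm (dg x\<^sub>0) + L * (\<alpha> * real k)"
          using norm_grad_le[OF that, of k] by (simp add: grad_bound_def)
        also have "\<dots> \<le> norm (dg x\<^sub>0) * real n + L * (\<alpha> * real n)"
          using \<open>k < n\<close> n1 L_pos \<alpha>_pos mult_left_mono[OF n1, of "norm (dg x\<^sub>0)"]
          by (intro add_mono mult_left_mono) auto
        finally show ?thesis by (simp add: algebra_simps)
      qed
      then have "expectation (\<lambda>\<omega>. (norm (grad k \<omega>))\<^sup>2) \<le> expectation (\<lambda>_. ((norm (dg x\<^sub>0) + L * \<alpha>) * real n)\<^sup>2)"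
        using norm_grad_square_integrable by (intro integral_mono power_mono) auto
      then show ?thesis by (simp add: prob_space power_mult_distrib)
    qed
    have "expectation (s n) \<le> s\<^sub>0 + \<sigma>\<^sub>0 * (\<Sum>k<n. expectation (\<lambda>\<omega>. (norm (grad k \<omega>))\<^sup>2)) + \<sigma>\<^sub>1 * real n"
      by (rule expectation_s)
    also have "(\<Sum>k<n. expectation (\<lambda>\<omega>. (norm (grad k \<omega>))\<^sup>2)) \<le> (\<Sum>k<n. (norm (dg x\<^sub>0) + L * \<alpha>)\<^sup>2 * (real n)\<^sup>2)"
      by (intro sum_mono grad_le) simp
    also have "s\<^sub>0 + \<sigma>\<^sub>0 * (\<Sum>k<n. (norm (dg x\<^sub>0) + L * \<alpha>)\<^sup>2 * (real n)\<^sup>2) + \<sigma>\<^sub>1 * real n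
        \<le> s\<^sub>0 * real n ^ 3 + \<sigma>\<^sub>0 * ((norm (dg x\<^sub>0) + L * \<alpha>)\<^sup>2 * real n ^ 3) + \<sigma>\<^sub>1 * real n ^ 3"
    proof -
      have cube: "(\<Sum>k<n. (norm (dg x\<^sub>0) + L * \<alpha>)\<^sup>2 * (real n)\<^sup>2) = (norm (dg x\<^sub>0) + L * \<alpha>)\<^sup>2 * real n ^ 3"
        by (simp add: power2_eq_square power3_eq_cube)
      have "s\<^sub>0 * 1 \<le> s\<^sub>0 * real n ^ 3"
        using s\<^sub>0_pos by (intro mult_left_mono one_le_power n1) simp
      moreover have "\<sigma>\<^sub>1 * real n ^ 1 \<le> \<sigma>\<^sub>1 * real n ^ 3"
        using \<sigma>1_pos by (intro mult_left_mono power_increasing n1) auto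
      ultimately show ?thesis unfolding cube by simp
    qed
    also have "\<dots> = s\<^sub>0 * P" using s\<^sub>0_pos by (simp add: P_def A_def field_simps)
    finally have s_le: "expectation (s n) \<le> s\<^sub>0 * P" using \<sigma>0_nonneg by (simp add: mult_left_mono)
    have "expectation (\<lambda>\<omega>. (K n \<omega>)\<^sup>2) \<le> expectation (\<lambda>\<omega>. 2 * (ln P)\<^sup>2 + 8 * (s n \<omega> / s\<^sub>0 / P))"
    proof (rule integral_mono)
      fix \<omega> assume \<omega>: "\<omega> \<in> space M"
      have "1 \<le> s n \<omega> / s\<^sub>0" using s\<^sub>0_pos by (simp add: s_eq[OF \<omega>] sum_nonneg)
      then show "(K n \<omega>)\<^sup>2 \<le> 2 * (ln P)\<^sup>2 + 8 * (s n \<omega> / s\<^sub>0 / P)"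
        using power_mono[OF K_bounds(2)[OF \<omega>, of n] K_bounds(1)[OF \<omega>], of 2] ln_square_le[OF _ P1]
        by (blast intro: order_trans)
    qed (use ess_bdd_integrable[OF ess_bdd_square[OF ess_bdd_K]] s_integrable in auto)
    also have "\<dots> = 2 * (ln P)\<^sup>2 + 8 * (expectation (s n) / s\<^sub>0 / P)"
      using s_integrable by (simp add: prob_space)
    also have "\<dots> \<le> 2 * (ln P)\<^sup>2 + 8"
      using s_le s\<^sub>0_pos P1 by (simp add: field_simps)
    also have "(ln P)\<^sup>2 \<le> (ln A + 3)\<^sup>2 * (ln n)\<^sup>2"
    proof -
      have "ln P = ln A + 3 * ln n" using A n1 by (simp add: P_def ln_mult ln_realpow)
      also have "\<dots> \<le> (ln A + 3) * ln n"
        using mult_left_mono[OF l, of "ln A"] A by (simp add: algebra_simps)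
      finally have "(ln P)\<^sup>2 \<le> ((ln A + 3) * ln n)\<^sup>2" using P1 by (intro power_mono) auto
      then show ?thesis by (simp add: power_mult_distrib)
    qed
    finally have "1 + expectation (\<lambda>\<omega>. (K n \<omega>)\<^sup>2) \<le> 2 * (ln A + 3)\<^sup>2 * (ln n)\<^sup>2 + 9" by simp
    moreover have "1 \<le> (ln (real n))\<^sup>2" using one_le_power[OF l] .
    ultimately show ?thesis by (simp add: C_def algebra_simps)
  qed
  moreover have "0 \<le> C" by (simp add: C_def)
  ultimately show ?thesis using that by blast
qed

text \<open>
  The right-hand side of \<open>sum_inner_gradient\<close> is split by Young's inequality before expectations are
  taken. The factor \<open>sqrt (s n)\<close> leads back to the sum on the left through the second moments of the
  gradient samples, and the remaining factor is logarithmic in mean square.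
\<close>

proposition sum_expectation_gradient_rate:
  obtains C where "0 \<le> C" "\<And>n. 3 \<le> n \<Longrightarrow>
    (\<Sum>k<n. expectation (\<lambda>\<omega>. (norm (grad k \<omega>))\<^sup>2)) \<le> C * (sqrt n * ln n)"
proof -
  obtain C\<^sub>R where C\<^sub>R: "0 \<le> C\<^sub>R"
    "\<And>n. expectation (\<lambda>\<omega>. (R n \<omega>)\<^sup>2) \<le> C\<^sub>R * (1 + expectation (\<lambda>\<omega>. (K n \<omega>)\<^sup>2))"
    by (rule expectation_R_square) blast
  obtain C\<^sub>K where C\<^sub>K: "0 \<le> C\<^sub>K" "\<And>n. 3 \<le> n \<Longrightarrow> 1 + expectation (\<lambda>\<omega>. (K n \<omega>)\<^sup>2) \<le> C\<^sub>K * (ln n)\<^sup>2"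
    by (rule expectation_K_square) blast
  define A where "A = sqrt s\<^sub>0 * g x\<^sub>0"
  define B where "B = C\<^sub>R * C\<^sub>K + (L * \<alpha>\<^sup>2)\<^sup>2"
  define C where "C = 2 / \<alpha> * (A + B + 2 * (\<sigma>\<^sub>0 / \<alpha> * B) + (s\<^sub>0 + \<sigma>\<^sub>1) / 2)"
  have A: "0 \<le> A" using s\<^sub>0_pos nonneg[of x\<^sub>0] by (simp add: A_def)
  have B: "0 \<le> B" using C\<^sub>R(1) C\<^sub>K(1) by (simp add: B_def)
  have "(\<Sum>k<n. expectation (\<lambda>\<omega>. (norm (grad k \<omega>))\<^sup>2)) \<le> C * (sqrt n * ln n)" if n: "3 \<le> n" for n
    unfolding C_def
  proof (rule self_bounding_rate[OF one_le_ln[OF n] _ _ \<alpha>_pos \<sigma>0_nonneg less_imp_le[OF \<sigma>1_pos]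
        less_imp_le[OF s\<^sub>0_pos] _ A B])
    show r: "1 \<le> sqrt (real n)" using n by simp
    have "ln (real n) = 2 * ln (sqrt (real n))" using n by (simp add: ln_sqrt)
    then show "ln (real n) \<le> 2 * sqrt (real n)" using ln_le_minus_one[of "sqrt (real n)"] r by simp
    let ?X = "\<Sum>k<n. expectation (\<lambda>\<omega>. (norm (grad k \<omega>))\<^sup>2)"
    show "0 \<le> ?X" by (intro sum_nonneg) simp
    fix \<mu> :: real assume \<mu>: "0 < \<mu>"
    note int = ess_bdd_integrable[OF ess_bdd_square[OF ess_bdd_R[of n]]] s_integrable[of n] inner_grad_integrable
    have "\<alpha> * ?X = expectation (\<lambda>\<omega>. \<alpha> * (\<Sum>k<n. inner (grad k \<omega>) (\<gamma> k \<omega>)))"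
      using int by (simp add: expectation_inner_grad)
    also have "\<dots> \<le> expectation (\<lambda>\<omega>. A + \<mu> * ((R n \<omega>)\<^sup>2 + (L * \<alpha>\<^sup>2)\<^sup>2) + s n \<omega> / (2 * \<mu>))"
    proof (rule integral_mono_AE)
      show "AE \<omega> in M. \<alpha> * (\<Sum>k<n. inner (grad k \<omega>) (\<gamma> k \<omega>))
          \<le> A + \<mu> * ((R n \<omega>)\<^sup>2 + (L * \<alpha>\<^sup>2)\<^sup>2) + s n \<omega> / (2 * \<mu>)"
        using R_bounds[of n] AE_space
      proof eventually_elim
        case (elim \<omega>)
        then have \<omega>: "\<omega> \<in> space M" by blast
        interpret P: adagrad_path g dg L "\<lambda>k. x k \<omega>" "\<lambda>k. \<gamma> k \<omega>" "\<lambda>k. s k \<omega>" \<alpha> \<sigma>\<^sub>0 \<sigma>\<^sub>1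
          by (rule path[OF \<omega>])
        let ?Q = "R n \<omega> + L * \<alpha>\<^sup>2" and ?t = "sqrt (s n \<omega>)"
        have "\<alpha> * (\<Sum>k<n. inner (grad k \<omega>) (\<gamma> k \<omega>)) \<le> A + ?Q * ?t"
          using P.sum_inner_gradient[of n "R n \<omega>"] elim R_nonneg[OF \<omega>]
          by (simp add: A_def s_0[OF \<omega>] x_0[OF \<omega>])
        also have "?Q * ?t \<le> \<mu> / 2 * ?Q\<^sup>2 + s n \<omega> / (2 * \<mu>)"
        proof -
          have "0 \<le> (\<mu> * ?Q - ?t)\<^sup>2 / (2 * \<mu>)" using \<mu> by simp
          also have "\<dots> = \<mu> / 2 * ?Q\<^sup>2 + ?t\<^sup>2 / (2 * \<mu>) - ?Q * ?t"
            using \<mu> by (simp add: power2_eq_square field_simps)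
          finally show ?thesis using P.s_pos[of n] by simp
        qed
        also have "\<mu> / 2 * ?Q\<^sup>2 \<le> \<mu> * ((R n \<omega>)\<^sup>2 + (L * \<alpha>\<^sup>2)\<^sup>2)"
        proof -
          have "?Q\<^sup>2 \<le> 2 * ((R n \<omega>)\<^sup>2 + (L * \<alpha>\<^sup>2)\<^sup>2)"
            using zero_le_power2[of "R n \<omega> - L * \<alpha>\<^sup>2"] by (simp add: power2_eq_square algebra_simps)
          from mult_left_mono[OF this, of "\<mu> / 2"] show ?thesis using \<mu> by simp
        qed
        finally show ?case by simp
      qed
    qed (use int in auto)
    also have "\<dots> = A + \<mu> * (expectation (\<lambda>\<omega>. (R n \<omega>)\<^sup>2) + (L * \<alpha>\<^sup>2)\<^sup>2) + expectation (s n) / (2 * \<mu>)"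
      using int by (simp add: prob_space)
    also have "\<dots> \<le> A + \<mu> * (B * (ln n)\<^sup>2) + (s\<^sub>0 + \<sigma>\<^sub>0 * ?X + \<sigma>\<^sub>1 * real n) / (2 * \<mu>)"
    proof (intro add_mono mult_left_mono divide_right_mono order_refl expectation_s)
      have "expectation (\<lambda>\<omega>. (R n \<omega>)\<^sup>2) \<le> C\<^sub>R * (C\<^sub>K * (ln n)\<^sup>2)"
        using C\<^sub>R(2)[of n] mult_left_mono[OF C\<^sub>K(2)[OF n] C\<^sub>R(1)] by linarith
      moreover have "(L * \<alpha>\<^sup>2)\<^sup>2 * 1 \<le> (L * \<alpha>\<^sup>2)\<^sup>2 * (ln n)\<^sup>2"
        using one_le_power[OF one_le_ln[OF n]] by (intro mult_left_mono) auto
      ultimately show "expectation (\<lambda>\<omega>. (R n \<omega>)\<^sup>2) + (L * \<alpha>\<^sup>2)\<^sup>2 \<le> B * (ln n)\<^sup>2"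
        by (simp add: B_def algebra_simps)
    qed (use \<mu> in auto)
    finally show "\<alpha> * ?X \<le> A + \<mu> * (B * (ln n)\<^sup>2) + (s\<^sub>0 + \<sigma>\<^sub>0 * ?X + \<sigma>\<^sub>1 * (sqrt (real n))\<^sup>2) / (2 * \<mu>)" by simp
  qed
  moreover have "0 \<le> C"
    using A B \<alpha>_pos \<sigma>0_nonneg \<sigma>1_pos s\<^sub>0_pos by (simp add: C_def)
  ultimately show ?thesis using that by blast
qed

end

section \<open>The noise filtration\<close>

lemma sets_noise_filtration_0: "sets (noise_filtration M N X \<xi> 0) = sigma_sets (space M) {{}, space M}"
  by (simp add: noise_filtration_def)

lemma sets_noise_filtration:
  assumes "0 < n"
  shows "sets (noise_filtration M N X \<xi> n) = sigma_sets (space M)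
    ({X -` A \<inter> space M | A. A \<in> sets borel} \<union>
     (\<Union>k\<in>{1..n}. {\<xi> k -` A \<inter> space M | A. A \<in> sets N}))"
proof -
  have "{X -` A \<inter> space M | A. A \<in> sets borel} \<union>
      (\<Union>k\<in>{1..n}. {\<xi> k -` A \<inter> space M | A. A \<in> sets N}) \<subseteq> Pow (space M)"
    by blast
  from sets_measure_of[OF this] show ?thesis
    using assms by (simp only: noise_filtration_def less_irrefl if_False split: if_split) simp
qed

lemma subalgebra_noise_filtration:
  assumes X: "X \<in> borel_measurable M" and \<xi>: "\<And>k. 1 \<le> k \<Longrightarrow> \<xi> k \<in> measurable M N"
  shows "subalgebra M (noise_filtration M N X \<xi> n)"
proof -
  have "sets (noise_filtration M N X \<xi> n) \<subseteq> sets M"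
  proof (cases "n = 0")
    case True
    show ?thesis unfolding True sets_noise_filtration_0 by (rule sets.sigma_sets_subset) simp
  next
    case False
    have "{X -` A \<inter> space M | A. A \<in> sets borel} \<subseteq> sets M"
      using measurable_sets[OF X] by blast
    moreover have "{\<xi> k -` A \<inter> space M | A. A \<in> sets N} \<subseteq> sets M" if "k \<in> {1..n}" for k
    proof -
      have "1 \<le> k" using that by simp
      then show ?thesis using measurable_sets[OF \<xi>] by blast
    qed
    ultimately show ?thesis
      unfolding sets_noise_filtration[OF False[unfolded neq0_conv]]
      by (intro sets.sigma_sets_subset Un_least UN_least)
  qed
  then show ?thesis by (simp add: subalgebra_def)
qed

lemma subalgebra_noise_filtration_Suc:
  "subalgebra (noise_filtration M N X \<xi> (Suc n)) (noise_filtration M N X \<xi> n)"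
proof -
  have "sets (noise_filtration M N X \<xi> n) \<subseteq> sets (noise_filtration M N X \<xi> (Suc n))"
  proof (cases "n = 0")
    case True
    have "sigma_sets (space M) {{}, space M} \<subseteq> sets (noise_filtration M N X \<xi> (Suc n))"
      using sets.sigma_sets_subset[of "{{}, space M}" "noise_filtration M N X \<xi> (Suc n)"]
        sets.top[of "noise_filtration M N X \<xi> (Suc n)"] by simp
    then show ?thesis unfolding True sets_noise_filtration_0 .
  next
    case False
    have "{1..n} \<subseteq> {1..Suc n}" by simp
    then have "(\<Union>k\<in>{1..n}. {\<xi> k -` A \<inter> space M | A. A \<in> sets N})
        \<subseteq> (\<Union>k\<in>{1..Suc n}. {\<xi> k -` A \<inter> space M | A. A \<in> sets N})"
      by (rule UN_mono) simp
    then show ?thesis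
      using False by (simp only: sets_noise_filtration zero_less_Suc neq0_conv)
        (intro sigma_sets_mono' Un_mono order_refl)
  qed
  then show ?thesis by (simp add: subalgebra_def)
qed

lemma Min_le_average:
  fixes e :: "nat \<Rightarrow> real"
  assumes "1 \<le> T"
  shows "(MIN n\<in>{1..T}. e n) \<le> 1 / real T * (\<Sum>n=1..T. e n)"
proof -
  have "real T * (MIN n\<in>{1..T}. e n) = (\<Sum>n=1..T. (MIN n\<in>{1..T}. e n))" by simp
  also have "\<dots> \<le> (\<Sum>n=1..T. e n)" by (intro sum_mono Min_le) auto
  finally show ?thesis using assms by (simp add: field_simps)
qed

theorem theorem4p1:
  fixes M :: "'w measure" and N :: "'x measure"
    and \<xi> :: "nat \<Rightarrow> 'w \<Rightarrow> 'x"
    and g :: "real ^ 'd \<Rightarrow> real" and grad_g :: "real ^ 'd \<Rightarrow> real ^ 'd"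
    and G :: "real ^ 'd \<Rightarrow> 'x \<Rightarrow> real ^ 'd"
    and \<theta> :: "nat \<Rightarrow> 'w \<Rightarrow> real ^ 'd" and S :: "nat \<Rightarrow> 'w \<Rightarrow> real"
    and \<theta>\<^sub>1 :: "real ^ 'd" and S\<^sub>0 \<alpha>\<^sub>0 L \<sigma>\<^sub>0 \<sigma>\<^sub>1 :: real
    and Fil :: "nat \<Rightarrow> 'w measure"
  assumes "prob_space M"
    and indep: "prob_space.indep_vars M (\<lambda>_. N) \<xi> {1..}"
    and grad: "\<And>x. GDERIV g x :> grad_g x"
    and cont_grad: "continuous_on UNIV grad_g"
    and nonneg: "\<And>x. 0 \<le> g x"
    and lipschitz: "\<And>x y. norm (grad_g x - grad_g y) \<le> L * norm (x - y)"
    and "0 < S\<^sub>0" and "0 < \<alpha>\<^sub>0"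
    and adagrad: "\<And>\<omega>. \<omega> \<in> space M \<Longrightarrow>
      adagrad_norm G \<theta>\<^sub>1 S\<^sub>0 \<alpha>\<^sub>0 (\<lambda>n. \<theta> n \<omega>) (\<lambda>n. S n \<omega>) (\<lambda>n. \<xi> n \<omega>)"
    and filtration: "\<And>n. Fil n = noise_filtration M N (\<theta> 1) \<xi> n"
    and adapted: "\<And>n. 1 \<le> n \<Longrightarrow> (\<lambda>\<omega>. G (\<theta> n \<omega>) (\<xi> n \<omega>)) \<in> borel_measurable (Fil n)"
    and "0 \<le> \<sigma>\<^sub>0" and "0 \<le> \<sigma>\<^sub>1"
    and unbiased: "\<And>n. 1 \<le> n \<Longrightarrow>
      AE \<omega> in M. vec_cond_exp M (Fil (n - 1)) (\<lambda>\<omega>. G (\<theta> n \<omega>) (\<xi> n \<omega>)) \<omega> = grad_g (\<theta> n \<omega>)"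
    and variance: "\<And>n. 1 \<le> n \<Longrightarrow>
      AE \<omega> in M. nn_cond_exp M (Fil (n - 1)) (\<lambda>\<omega>. ennreal ((norm (G (\<theta> n \<omega>) (\<xi> n \<omega>)))\<^sup>2)) \<omega>
        \<le> ennreal (\<sigma>\<^sub>0 * (norm (grad_g (\<theta> n \<omega>)))\<^sup>2 + \<sigma>\<^sub>1)"
  shows "(\<forall>n\<ge>1. integrable M (\<lambda>\<omega>. (norm (grad_g (\<theta> n \<omega>)))\<^sup>2)) \<and>
    (\<lambda>T::nat. 1 / real T *
        (\<Sum>n=1..T. prob_space.expectation M (\<lambda>\<omega>. (norm (grad_g (\<theta> n \<omega>)))\<^sup>2)))
      \<in> O(\<lambda>T. ln (real T) / sqrt (real T)) \<and>
    (\<lambda>T::nat. MIN n\<in>{1..T}. prob_space.expectation M (\<lambda>\<omega>. (norm (grad_g (\<theta> n \<omega>)))\<^sup>2))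
      \<in> O(\<lambda>T. ln (real T) / sqrt (real T))"
proof -
  interpret prob_space M by fact
  have run: "\<theta> 1 \<omega> = \<theta>\<^sub>1" "S 0 \<omega> = S\<^sub>0"
    "S (Suc n) \<omega> = S n \<omega> + (norm (G (\<theta> (Suc n) \<omega>) (\<xi> (Suc n) \<omega>)))\<^sup>2"
    "\<theta> (Suc (Suc n)) \<omega> = \<theta> (Suc n) \<omega> - (\<alpha>\<^sub>0 / sqrt (S (Suc n) \<omega>)) *\<^sub>R G (\<theta> (Suc n) \<omega>) (\<xi> (Suc n) \<omega>)"
    if "\<omega> \<in> space M" for n \<omega>
    using adagrad[OF that] by (auto simp: adagrad_norm_def dest!: spec[of _ "Suc n"])
  have \<theta>_1: "\<theta> 1 \<in> borel_measurable M"
    using run(1) by (subst measurable_cong[of M _ "\<lambda>_. \<theta>\<^sub>1"]) auto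
  have \<xi>: "\<xi> k \<in> measurable M N" if "1 \<le> k" for k
    using indep that by (auto simp: indep_vars_def)
  \<comment> \<open>
    The Lipschitz constant and the additive noise constant become denominators, and both may be
    enlarged to make them positive.
  \<close>
  interpret adagrad_process M g grad_g "max L 1" Fil "\<lambda>n. \<theta> (Suc n)"
    "\<lambda>n \<omega>. G (\<theta> (Suc n) \<omega>) (\<xi> (Suc n) \<omega>)" S \<alpha>\<^sub>0 \<sigma>\<^sub>0 "\<sigma>\<^sub>1 + 1" \<theta>\<^sub>1 S\<^sub>0
  proof
    show "norm (grad_g y - grad_g z) \<le> max L 1 * norm (y - z)" for y z
      by (rule order_trans[OF lipschitz]) (simp add: mult_right_mono)
    show "subalgebra M (Fil n)" for n
      unfolding filtration by (rule subalgebra_noise_filtration[OF \<theta>_1 \<xi>])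
    show "subalgebra (Fil (Suc n)) (Fil n)" for n
      unfolding filtration by (rule subalgebra_noise_filtration_Suc)
    fix n
    show "(\<lambda>\<omega>. G (\<theta> (Suc n) \<omega>) (\<xi> (Suc n) \<omega>)) \<in> borel_measurable (Fil (Suc n))"
      by (rule adapted) simp
    show "AE \<omega> in M. real_cond_exp M (Fil n) (\<lambda>\<omega>. inner (G (\<theta> (Suc n) \<omega>) (\<xi> (Suc n) \<omega>)) b) \<omega>
        = inner (grad_g (\<theta> (Suc n) \<omega>)) b" if "b \<in> Basis" for b
    proof -
      obtain i where b: "b = axis i 1" using \<open>b \<in> Basis\<close> by (auto simp: Basis_vec_def)
      show ?thesis
        using unbiased[of "Suc n"] by (auto simp: vec_cond_exp_def vec_eq_iff b inner_axis)
    qed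
    show "AE \<omega> in M. nn_cond_exp M (Fil n) (\<lambda>\<omega>. ennreal ((norm (G (\<theta> (Suc n) \<omega>) (\<xi> (Suc n) \<omega>)))\<^sup>2)) \<omega>
        \<le> ennreal (\<sigma>\<^sub>0 * (norm (grad_g (\<theta> (Suc n) \<omega>)))\<^sup>2 + (\<sigma>\<^sub>1 + 1))"
      using variance[of "Suc n", simplified]
      by eventually_elim (rule order_trans, assumption, rule ennreal_leI, simp)
  qed (fact assms | rule run[unfolded One_nat_def], assumption | use \<open>0 \<le> \<sigma>\<^sub>1\<close> in simp)+
  define e where "e n = expectation (\<lambda>\<omega>. (norm (grad_g (\<theta> n \<omega>)))\<^sup>2)" for n
  obtain C where C: "0 \<le> C" "\<And>n. 3 \<le> n \<Longrightarrow> (\<Sum>k<n. e (Suc k)) \<le> C * (sqrt n * ln n)"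
    unfolding e_def by (rule sum_expectation_gradient_rate) blast
  have e_nonneg: "0 \<le> e n" for n by (simp add: e_def)
  have avg: "1 / real T * (\<Sum>n=1..T. e n) \<le> C * (ln (real T) / sqrt (real T))" if "3 \<le> T" for T
  proof -
    have "(\<Sum>n=1..T. e n) \<le> C * (sqrt T * ln T)"
      using C(2)[OF that] by (simp add: sum.atLeast1_atMost_eq)
    then have "1 / real T * (\<Sum>n=1..T. e n) \<le> 1 / real T * (C * (sqrt T * ln T))"
      by (intro mult_left_mono) auto
    also have "\<dots> = C * (ln T * (sqrt T / real T))" by simp
    also have "sqrt T / real T = 1 / sqrt T" using that by (simp add: real_divide_square_eq field_simps)
    finally show ?thesis by simp
  qed
  have "(\<lambda>T. 1 / real T * (\<Sum>n=1..T. e n)) \<in> O(\<lambda>T. ln (real T) / sqrt (real T))"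
  proof (rule bigoI[of _ C])
    show "\<forall>\<^sub>F T in sequentially. norm (1 / real T * (\<Sum>n=1..T. e n)) \<le> C * norm (ln (real T) / sqrt (real T))"
      using eventually_ge_at_top[of "3::nat"]
      by eventually_elim (use avg e_nonneg in \<open>auto simp: sum_nonneg\<close>)
  qed
  moreover have "(\<lambda>T. MIN n\<in>{1..T}. e n) \<in> O(\<lambda>T. ln (real T) / sqrt (real T))"
  proof (rule bigoI[of _ C])
    show "\<forall>\<^sub>F T in sequentially. norm (MIN n\<in>{1..T}. e n) \<le> C * norm (ln (real T) / sqrt (real T))"
      using eventually_ge_at_top[of "3::nat"]
    proof eventually_elim
      case (elim T)
      have "0 \<le> (MIN n\<in>{1..T}. e n)" using elim e_nonneg by (intro Min.boundedI) auto
      moreover have "(MIN n\<in>{1..T}. e n) \<le> C * (ln (real T) / sqrt (real T))"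
        using Min_le_average[of T e] avg[OF elim] elim by linarith
      ultimately show ?case using elim by simp
    qed
  qed
  moreover have "integrable M (\<lambda>\<omega>. (norm (grad_g (\<theta> n \<omega>)))\<^sup>2)" if "1 \<le> n" for n
    using norm_grad_square_integrable[of "n - 1"] that by simp
  ultimately show ?thesis unfolding e_def by blast
qed

end
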